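(* Let $\alpha$ be a continuous partial action of a monoid $M$ on a topological space $X$, with topological globalization $Y$. Suppose $\alpha$ is closed and confluent. If $X$ is normal, then $Y$ is normal. If moreover $\dim(X)=n$, then $\dim(Y)=n$.
   Context: Normal spaces are assumed to be $T_1$; $\dim$ is (Lebesgue) covering dimension. Partial action: a partial map $M\times X\to X$, $(u,x)\mapsto u\cdot x$, with $e\cdot x=x$ for all $x$ ($e$ the unit of $M$) and such that, whenever $v\cdot x$ is defined, $(uv)\cdot x$ is defined iff $u\cdot(v\cdot x)$ is defined, in which case they are equal. $\operatorname{dom}(u)$ is the set of $x\in X$ with $u\cdot x$ defined. The partial action is continuous if each map $u:\operatorname{dom}(u)\to X$, $x\mapsto u\cdot x$, is continuous; it is closed if $\operatorname{dom}(u)$ is closed in $X$ for each $u\in M$. Globalization: $Y=(M\times X)/{\simeq}$, where $\simeq$ is the equivalence relation generated by $(uv,x)\sim(u,v\cdot x)$ whenever $v\cdot x$ is defined; $[u,x]$ is the class of $(u,x)$. $M$ acts on $Y$ by $u\cdot[v,x]=[uv,x]$. $Y$ carries the final topology with respect to all maps $X\to Y$, $x\mapsto[u,x]$, $u\in M$. Confluence: A monoid presentation $\langle G\mid R\rangle$ consists of a set $G$ and a set $R\subset G^*\times G^*$ of directed reduction rules $l\to r$ ($G^*$ is the set of finite words over $G$). It induces a one-step reduction $w_1lw_2\to w_1rw_2$ on $G^*$; the presented monoid is $G^*$ modulo the equivalence relation generated by $\to$. A word is normal if no one-step reduction applies to it; a normal form of $w$ is a normal word equivalent to $w$. The presentation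 is confluent if there is no infinite sequence of one-step reductions, every word has a unique normal form, and no rule has a left side consisting of a single letter. Given a presentation of $M$, one-step reduction on $G^*\times X$ is defined by $(g_n\dots g_1,x)\to(g_n\dots g_2,g_1\cdot x)$ whenever $g_1\cdot x$ is defined, and $(w_1,x)\to(w_2,x)$ whenever $w_1\to w_2$ in $G^*$; normality and normal forms are defined as before. The partial action is confluent if $M$ has a confluent presentation $\langle G\mid R\rangle$ such that every element of $G^*\times X$ has a unique normal form and, whenever $(g_n\dots g_1)\cdot x=y$ holds in $X$ (with $g_i\in G$), $(g_n\dots g_1,x)$ can be transformed into $((),y)$ by finitely many one-step reductions, where $()$ is the empty word. *)

theory Defs
  imports "HOL-Analysis.Analysis" "HOL-Algebra.Group"
begin

section \<open>Abstract reduction: normal forms\<close>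

definition normal_elem :: "('a \<Rightarrow> 'a \<Rightarrow> bool) \<Rightarrow> 'a \<Rightarrow> bool" where
  "normal_elem r x \<longleftrightarrow> \<not> (\<exists>y. r x y)"

definition normal_form_of :: "('a \<Rightarrow> 'a \<Rightarrow> bool) \<Rightarrow> 'a \<Rightarrow> 'a \<Rightarrow> bool" where
  "normal_form_of r x y \<longleftrightarrow> equivclp r x y \<and> normal_elem r y"


section \<open>Partial monoid actions\<close>

text \<open>A partial map from \<open>M \<times> X\<close> to \<open>X\<close> is a function into \<open>'x option\<close>, \<open>None\<close> meaning undefined;
  its values outside \<open>carrier M\<close> and \<open>S\<close> are irrelevant.  The equation \<open>act (u \<otimes> v) x = act u y\<close>
  between options says that one side is defined iff the other is, with equal values.\<close>

definition partial_action :: "('m, 'b) monoid_scheme \<Rightarrow> 'x set \<Rightarrow> ('m \<Rightarrow> 'x \<rightharpoonup> 'x) \<Rightarrow> bool" where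
  "partial_action M S act \<longleftrightarrow>
     (\<forall>u\<in>carrier M. \<forall>x\<in>S. \<forall>y. act u x = Some y \<longrightarrow> y \<in> S) \<and>
     (\<forall>x\<in>S. act \<one>\<^bsub>M\<^esub> x = Some x) \<and>
     (\<forall>u\<in>carrier M. \<forall>v\<in>carrier M. \<forall>x\<in>S. \<forall>y.
        act v x = Some y \<longrightarrow> act (u \<otimes>\<^bsub>M\<^esub> v) x = act u y)"

definition act_dom :: "'x set \<Rightarrow> ('m \<Rightarrow> 'x \<rightharpoonup> 'x) \<Rightarrow> 'm \<Rightarrow> 'x set" where
  "act_dom S act u = {x \<in> S. act u x \<noteq> None}"

definition continuous_partial_action ::
    "('m, 'b) monoid_scheme \<Rightarrow> 'x topology \<Rightarrow> ('m \<Rightarrow> 'x \<rightharpoonup> 'x) \<Rightarrow> bool" where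
  "continuous_partial_action M X act \<longleftrightarrow>
     partial_action M (topspace X) act \<and>
     (\<forall>u\<in>carrier M. continuous_map (subtopology X (act_dom (topspace X) act u)) X
        (\<lambda>x. the (act u x)))"

definition closed_partial_action ::
    "('m, 'b) monoid_scheme \<Rightarrow> 'x topology \<Rightarrow> ('m \<Rightarrow> 'x \<rightharpoonup> 'x) \<Rightarrow> bool" where
  "closed_partial_action M X act \<longleftrightarrow>
     (\<forall>u\<in>carrier M. closedin X (act_dom (topspace X) act u))"


section \<open>The globalization and its topology\<close>

inductive glob_step ::
    "('m, 'b) monoid_scheme \<Rightarrow> 'x set \<Rightarrow> ('m \<Rightarrow> 'x \<rightharpoonup> 'x) \<Rightarrow> 'm \<times> 'x \<Rightarrow> 'm \<times> 'x \<Rightarrow> bool"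
  for M :: "('m, 'b) monoid_scheme" and S :: "'x set" and act :: "'m \<Rightarrow> 'x \<rightharpoonup> 'x" where
  "\<lbrakk>u \<in> carrier M; v \<in> carrier M; x \<in> S; act v x = Some y\<rbrakk>
     \<Longrightarrow> glob_step M S act (u \<otimes>\<^bsub>M\<^esub> v, x) (u, y)"

definition glob_rel ::
    "('m, 'b) monoid_scheme \<Rightarrow> 'x set \<Rightarrow> ('m \<Rightarrow> 'x \<rightharpoonup> 'x) \<Rightarrow> (('m \<times> 'x) \<times> ('m \<times> 'x)) set" where
  "glob_rel M S act =
     {(p, q). p \<in> carrier M \<times> S \<and> q \<in> carrier M \<times> S \<and> equivclp (glob_step M S act) p q}"

definition glob_points ::
    "('m, 'b) monoid_scheme \<Rightarrow> 'x set \<Rightarrow> ('m \<Rightarrow> 'x \<rightharpoonup> 'x) \<Rightarrow> ('m \<times> 'x) set set" where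
  "glob_points M S act = (carrier M \<times> S) // glob_rel M S act"

definition glob_class ::
    "('m, 'b) monoid_scheme \<Rightarrow> 'x set \<Rightarrow> ('m \<Rightarrow> 'x \<rightharpoonup> 'x) \<Rightarrow> 'm \<Rightarrow> 'x \<Rightarrow> ('m \<times> 'x) set" where
  "glob_class M S act u x = glob_rel M S act `` {(u, x)}"

definition globalization ::
    "('m, 'b) monoid_scheme \<Rightarrow> 'x topology \<Rightarrow> ('m \<Rightarrow> 'x \<rightharpoonup> 'x) \<Rightarrow> ('m \<times> 'x) set topology" where
  "globalization M X act = topology (\<lambda>U.
     U \<subseteq> glob_points M (topspace X) act \<and>
     (\<forall>u\<in>carrier M. openin X {x \<in> topspace X. glob_class M (topspace X) act u x \<in> U}))"

lemma equiv_glob_rel: "equiv (carrier M \<times> S) (glob_rel M S act)"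
  by (rule equivI)
    (auto simp: glob_rel_def refl_on_def sym_def trans_def
      intro: equivclp_sym equivclp_trans)

lemma istopology_globalization:
  "istopology (\<lambda>U.
     U \<subseteq> glob_points M (topspace X) act \<and>
     (\<forall>u\<in>carrier M. openin X {x \<in> topspace X. glob_class M (topspace X) act u x \<in> U}))"
  unfolding istopology_def
proof (intro conjI allI impI ballI)
  fix U V u
  let ?c = "glob_class M (topspace X) act"
  assume "U \<subseteq> glob_points M (topspace X) act \<and>
     (\<forall>u\<in>carrier M. openin X {x \<in> topspace X. ?c u x \<in> U})"
    and "V \<subseteq> glob_points M (topspace X) act \<and>
     (\<forall>u\<in>carrier M. openin X {x \<in> topspace X. ?c u x \<in> V})" and "u \<in> carrier M"
  then have "openin X ({x \<in> topspace X. ?c u x \<in> U} \<inter> {x \<in> topspace X. ?c u x \<in> V})"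
    by auto
  moreover have "{x \<in> topspace X. ?c u x \<in> U} \<inter> {x \<in> topspace X. ?c u x \<in> V}
      = {x \<in> topspace X. ?c u x \<in> U \<inter> V}"
    by auto
  ultimately show "openin X {x \<in> topspace X. ?c u x \<in> U \<inter> V}" by simp
next
  fix K u
  let ?c = "glob_class M (topspace X) act"
  assume "\<forall>U\<in>K. U \<subseteq> glob_points M (topspace X) act \<and>
     (\<forall>u\<in>carrier M. openin X {x \<in> topspace X. ?c u x \<in> U})" and "u \<in> carrier M"
  then have "openin X (\<Union>U\<in>K. {x \<in> topspace X. ?c u x \<in> U})"
    by auto
  moreover have "(\<Union>U\<in>K. {x \<in> topspace X. ?c u x \<in> U})
      = {x \<in> topspace X. ?c u x \<in> \<Union>K}"
    by auto
  ultimately show "openin X {x \<in> topspace X. ?c u x \<in> \<Union>K}" by simp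
qed auto

lemma openin_globalization:
  "openin (globalization M X act) U \<longleftrightarrow>
     U \<subseteq> glob_points M (topspace X) act \<and>
     (\<forall>u\<in>carrier M. openin X {x \<in> topspace X. glob_class M (topspace X) act u x \<in> U})"
  unfolding globalization_def by (simp only: topology_inverse'[OF istopology_globalization])

lemma topspace_globalization:
  "topspace (globalization M X act) = glob_points M (topspace X) act"
proof -
  have "{x \<in> topspace X. glob_class M (topspace X) act u x \<in> glob_points M (topspace X) act}
          = topspace X" if "u \<in> carrier M" for u
    using that by (auto simp: glob_class_def glob_points_def intro: quotientI)
  then have "openin (globalization M X act) (glob_points M (topspace X) act)"
    by (auto simp: openin_globalization)
  then have "glob_points M (topspace X) act \<subseteq> topspace (globalization M X act)"
    by (rule openin_subset)
  moreover have "topspace (globalization M X act) \<subseteq> glob_points M (topspace X) act"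
    using openin_topspace[of "globalization M X act"] unfolding openin_globalization by blast
  ultimately show ?thesis by (rule subset_antisym[rotated])
qed


section \<open>Monoid presentations and confluence\<close>

inductive word_step :: "'g set \<Rightarrow> ('g list \<times> 'g list) set \<Rightarrow> 'g list \<Rightarrow> 'g list \<Rightarrow> bool"
  for G :: "'g set" and R :: "('g list \<times> 'g list) set" where
  "\<lbrakk>w\<^sub>1 \<in> lists G; w\<^sub>2 \<in> lists G; (l, r) \<in> R\<rbrakk>
     \<Longrightarrow> word_step G R (w\<^sub>1 @ l @ w\<^sub>2) (w\<^sub>1 @ r @ w\<^sub>2)"

definition word_rel :: "'g set \<Rightarrow> ('g list \<times> 'g list) set \<Rightarrow> ('g list \<times> 'g list) set" where
  "word_rel G R = {(v, w). v \<in> lists G \<and> w \<in> lists G \<and> equivclp (word_step G R) v w}"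

definition presented_monoid :: "'g set \<Rightarrow> ('g list \<times> 'g list) set \<Rightarrow> 'g list set monoid" where
  "presented_monoid G R =
     \<lparr>carrier = lists G // word_rel G R,
      monoid.mult = (\<lambda>A B. \<Union>v\<in>A. \<Union>w\<in>B. word_rel G R `` {v @ w}),
      one = word_rel G R `` {[]}\<rparr>"

definition confluent_presentation :: "'g set \<Rightarrow> ('g list \<times> 'g list) set \<Rightarrow> bool" where
  "confluent_presentation G R \<longleftrightarrow>
     R \<subseteq> lists G \<times> lists G \<and>
     \<not> (\<exists>f. \<forall>i::nat. word_step G R (f i) (f (Suc i))) \<and>
     (\<forall>w\<in>lists G. \<exists>!v. normal_form_of (word_step G R) w v) \<and>
     (\<forall>(l, r)\<in>R. length l \<noteq> 1)"

text \<open>A presentation of \<open>M\<close> consists of \<open>G\<close>, \<open>R\<close> and an isomorphism \<open>\<phi>\<close> from the presented monoid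
  onto \<open>M\<close>; the following is the element of \<open>M\<close> represented by a word.\<close>

definition word_val ::
    "'g set \<Rightarrow> ('g list \<times> 'g list) set \<Rightarrow> ('g list set \<Rightarrow> 'm) \<Rightarrow> 'g list \<Rightarrow> 'm" where
  "word_val G R \<phi> w = \<phi> (word_rel G R `` {w})"

text \<open>The word \<open>g\<^sub>n\<dots>g\<^sub>1\<close> is the list \<open>[g\<^sub>n, \<dots>, g\<^sub>1]\<close>, so the letter that acts first comes last.\<close>

inductive act_step ::
    "'g set \<Rightarrow> ('g list \<times> 'g list) set \<Rightarrow> ('g list set \<Rightarrow> 'm) \<Rightarrow> 'x set \<Rightarrow> ('m \<Rightarrow> 'x \<rightharpoonup> 'x)
       \<Rightarrow> 'g list \<times> 'x \<Rightarrow> 'g list \<times> 'x \<Rightarrow> bool"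
  for G :: "'g set" and R :: "('g list \<times> 'g list) set" and \<phi> :: "'g list set \<Rightarrow> 'm"
    and S :: "'x set" and act :: "'m \<Rightarrow> 'x \<rightharpoonup> 'x" where
  apply_letter: "\<lbrakk>w \<in> lists G; g \<in> G; x \<in> S; act (word_val G R \<phi> [g]) x = Some y\<rbrakk>
     \<Longrightarrow> act_step G R \<phi> S act (w @ [g], x) (w, y)"
| reduce_word: "\<lbrakk>word_step G R w\<^sub>1 w\<^sub>2; x \<in> S\<rbrakk> \<Longrightarrow> act_step G R \<phi> S act (w\<^sub>1, x) (w\<^sub>2, x)"

text \<open>The argument \<open>'g itself\<close> is the type from which the generators of the presentation are taken,
  since existential quantification over types is not available.  In a hypothesis of a theorem with
  free type variable \<open>'g\<close> no restriction on the generating set results.\<close>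

definition confluent_partial_action ::
    "'g itself \<Rightarrow> ('m, 'b) monoid_scheme \<Rightarrow> 'x set \<Rightarrow> ('m \<Rightarrow> 'x \<rightharpoonup> 'x) \<Rightarrow> bool" where
  "confluent_partial_action _ M S act \<longleftrightarrow>
     (\<exists>(G::'g set) R \<phi>.
        confluent_presentation G R \<and>
        \<phi> \<in> iso (presented_monoid G R) M \<and>
        (\<forall>w\<in>lists G. \<forall>x\<in>S. \<exists>!q. normal_form_of (act_step G R \<phi> S act) (w, x) q) \<and>
        (\<forall>w\<in>lists G. \<forall>x\<in>S. \<forall>y. act (word_val G R \<phi> w) x = Some y \<longrightarrow>
           (act_step G R \<phi> S act)\<^sup>*\<^sup>* (w, x) ([], y)))"

lemma equiv_word_rel: "equiv (lists G) (word_rel G R)"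
  by (rule equivI)
    (auto simp: word_rel_def refl_on_def sym_def trans_def
      intro: equivclp_sym equivclp_trans)

lemma word_step_append:
  assumes "word_step G R v w" "a \<in> lists G" "b \<in> lists G"
  shows "word_step G R (a @ v @ b) (a @ w @ b)"
  using assms(1)
proof cases
  case (1 w\<^sub>1 w\<^sub>2 l r)
  have "word_step G R ((a @ w\<^sub>1) @ l @ (w\<^sub>2 @ b)) ((a @ w\<^sub>1) @ r @ (w\<^sub>2 @ b))"
    using 1 assms by (intro word_step.intros) auto
  then show ?thesis using 1 by simp
qed

lemma equivclp_word_step_append:
  assumes "equivclp (word_step G R) v w" "a \<in> lists G" "b \<in> lists G"
  shows "equivclp (word_step G R) (a @ v @ b) (a @ w @ b)"
  using assms(1)
proof (induction rule: equivclp_induct)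
  case (step y z)
  then show ?case
    using word_step_append[OF _ assms(2,3)] by (meson equivclp_into_equivclp)
qed simp

lemma word_rel_append:
  assumes "(v, v') \<in> word_rel G R" "(w, w') \<in> word_rel G R"
  shows "(v @ w, v' @ w') \<in> word_rel G R"
proof -
  have "equivclp (word_step G R) (v @ w) (v' @ w)"
    using equivclp_word_step_append[of G R v v' "[]" w] assms by (auto simp: word_rel_def)
  moreover have "equivclp (word_step G R) (v' @ w) (v' @ w')"
    using equivclp_word_step_append[of G R w w' v' "[]"] assms by (auto simp: word_rel_def)
  ultimately show ?thesis
    using assms by (auto simp: word_rel_def intro: equivclp_trans)
qed

lemma presented_monoid_mult:
  assumes "v \<in> lists G" "w \<in> lists G"
  shows "(word_rel G R `` {v}) \<otimes>\<^bsub>presented_monoid G R\<^esub> (word_rel G R `` {w})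
           = word_rel G R `` {v @ w}"
proof -
  have "congruent2 (word_rel G R) (word_rel G R) (\<lambda>v w. word_rel G R `` {v @ w})"
    unfolding congruent2_def using equiv_class_eq[OF equiv_word_rel] word_rel_append by blast
  then show ?thesis
    using UN_equiv_class2[OF equiv_word_rel equiv_word_rel _ assms]
    by (simp add: presented_monoid_def)
qed

lemma monoid_presented_monoid: "monoid (presented_monoid G R)"
proof -
  let ?P = "presented_monoid G R" and ?c = "\<lambda>w. word_rel G R `` {w}"
  have car: "carrier ?P = ?c ` lists G"
    by (simp only: presented_monoid_def quotient_def partial_object.simps UNION_singleton_eq_range)
  have one: "\<one>\<^bsub>?P\<^esub> = ?c []"
    by (simp add: presented_monoid_def)
  have mult: "?c v \<otimes>\<^bsub>?P\<^esub> ?c w = ?c (v @ w)" if "v \<in> lists G" "w \<in> lists G" for v w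
    using that by (rule presented_monoid_mult)
  have app: "v @ w \<in> lists G" if "v \<in> lists G" "w \<in> lists G" for v w
    using that by simp
  have rep: thesis if "x \<in> carrier ?P" "\<And>u. x = ?c u \<Longrightarrow> u \<in> lists G \<Longrightarrow> thesis" for x thesis
    using that(1) unfolding car by (elim imageE) (rule that(2))
  have nil: "[] \<in> lists G" by simp
  show ?thesis
  proof (rule monoidI)
    show "\<one>\<^bsub>?P\<^esub> \<in> carrier ?P"
      unfolding car one using nil by (rule imageI)
  next
    fix x y assume x: "x \<in> carrier ?P" and y: "y \<in> carrier ?P"
    show "x \<otimes>\<^bsub>?P\<^esub> y \<in> carrier ?P"
    proof (rule rep[OF x], rule rep[OF y])
      fix u v assume u: "x = ?c u" "u \<in> lists G" and v: "y = ?c v" "v \<in> lists G"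
      show ?thesis
        unfolding u(1) v(1) mult[OF u(2) v(2)] car by (rule imageI, rule app[OF u(2) v(2)])
    qed
  next
    fix x y z assume x: "x \<in> carrier ?P" and y: "y \<in> carrier ?P" and z: "z \<in> carrier ?P"
    show "x \<otimes>\<^bsub>?P\<^esub> y \<otimes>\<^bsub>?P\<^esub> z = x \<otimes>\<^bsub>?P\<^esub> (y \<otimes>\<^bsub>?P\<^esub> z)"
    proof (rule rep[OF x], rule rep[OF y], rule rep[OF z])
      fix u v w assume u: "x = ?c u" "u \<in> lists G" and v: "y = ?c v" "v \<in> lists G"
        and w: "z = ?c w" "w \<in> lists G"
      show ?thesis
        unfolding u(1) v(1) w(1) mult[OF u(2) v(2)] mult[OF v(2) w(2)]
          mult[OF app[OF u(2) v(2)] w(2)] mult[OF u(2) app[OF v(2) w(2)]] append_assoc ..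
    qed
  next
    fix x assume x: "x \<in> carrier ?P"
    show "\<one>\<^bsub>?P\<^esub> \<otimes>\<^bsub>?P\<^esub> x = x"
    proof (rule rep[OF x])
      fix u assume u: "x = ?c u" "u \<in> lists G"
      show ?thesis unfolding u(1) one mult[OF nil u(2)] append_Nil ..
    qed
    show "x \<otimes>\<^bsub>?P\<^esub> \<one>\<^bsub>?P\<^esub> = x"
    proof (rule rep[OF x])
      fix u assume u: "x = ?c u" "u \<in> lists G"
      show ?thesis unfolding u(1) one mult[OF u(2) nil] append_Nil2 ..
    qed
  qed
qed


section \<open>Normality and covering dimension\<close>

definition normal_T1_space :: "'a topology \<Rightarrow> bool" where
  "normal_T1_space X \<longleftrightarrow> normal_space X \<and> t1_space X"

definition open_cover :: "'a topology \<Rightarrow> 'a set set \<Rightarrow> bool" where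
  "open_cover X \<U> \<longleftrightarrow> (\<forall>U\<in>\<U>. openin X U) \<and> \<Union>\<U> = topspace X"

text \<open>Covering dimension in terms of finite open covers, as is standard for normal spaces, with
  values in \<open>{-1, 0, 1, \<dots>, \<infinity>}\<close>; the empty space is the only one of dimension \<open>-1\<close>, and the
  dimension is \<open>\<infinity>\<close> if no finite bound exists.\<close>

definition covering_dim_le :: "'a topology \<Rightarrow> int \<Rightarrow> bool" where
  "covering_dim_le X n \<longleftrightarrow>
     (\<forall>\<U>. finite \<U> \<and> open_cover X \<U> \<longrightarrow>
        (\<exists>\<V>. finite \<V> \<and> open_cover X \<V> \<and> (\<forall>V\<in>\<V>. \<exists>U\<in>\<U>. V \<subseteq> U) \<and>
             (\<forall>x\<in>topspace X. int (card {V \<in> \<V>. x \<in> V}) \<le> n + 1)))"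

definition covering_dim :: "'a topology \<Rightarrow> ereal" where
  "covering_dim X = Inf {ereal (real_of_int n) |n. -1 \<le> n \<and> covering_dim_le X n}"

end

theory Submission
  imports Defs
begin

text \<open>By confluence, each point of the globalization \<open>Y\<close> is \<open>[w, x]\<close> for exactly one pair of a normal
  word \<open>w\<close> and a point \<open>x\<close> at which the first letter to act is undefined.  So \<open>Y\<close> arises from \<open>X\<close> by
  attaching, for each normal word \<open>wg\<close> in order of length, a copy of \<open>X\<close> along the closed set \<open>dom g\<close>,
  and a continuous function on \<open>Y\<close> can be built by recursion on words as soon as functions of the
  required kind extend from closed subsets of \<open>X\<close>.  Tietze's theorem then gives Urysohn functions
  on \<open>Y\<close>.  If \<open>dim X \<le> n\<close>, partitions of unity with at most \<open>n + 1\<close> nonzero members at each point,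
  subordinate to a given finite open cover, also extend from closed sets; gluing them gives
  \<open>dim Y \<le> n\<close>.  Conversely \<open>X\<close> is a closed subspace of \<open>Y\<close>.\<close>

section \<open>Extension of partitions of unity\<close>

text \<open>The three prescriptions agree on overlaps and live on closed sets, so they paste to a
  continuous function, which Tietze extends. This serves Urysohn functions on each new copy of
  \<open>X\<close> and, with \<open>B\<close> empty, single coordinates that must vanish off an open
  set.\<close>

lemma continuous_map_extension_with_zeros_and_ones:
  fixes d :: "'a \<Rightarrow> real"
  assumes "normal_space X" "closedin X D" "closedin X A" "closedin X B" "disjnt A B"
    and d: "continuous_map (subtopology X D) euclideanreal d"
    and dA: "\<And>x. x \<in> D \<Longrightarrow> x \<in> A \<Longrightarrow> d x = 0" and dB: "\<And>x. x \<in> D \<Longrightarrow> x \<in> B \<Longrightarrow> d x = 1"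
  obtains h where "continuous_map X euclideanreal h" "\<And>x. x \<in> D \<Longrightarrow> h x = d x"
    "\<And>x. x \<in> A \<Longrightarrow> h x = 0" "\<And>x. x \<in> B \<Longrightarrow> h x = 1"
proof -
  define e where "e x = (if x \<in> D then d x else if x \<in> A then 0 else 1)" for x
  let ?C = "D \<union> A \<union> B"
  have C: "closedin X ?C" using assms by blast
  have e: "e x = d x" if "x \<in> D" for x using that by (simp add: e_def)
  have eA: "e x = 0" if "x \<in> A" for x using that dA by (simp add: e_def)
  have eB: "e x = 1" if "x \<in> B" for x
    using that dB \<open>disjnt A B\<close> by (auto simp: e_def disjnt_iff)
  have "continuous_map (subtopology X ?C) euclideanreal e"
    unfolding continuous_map_closedin
  proof (intro conjI allI impI)
    fix T :: "real set" assume T: "closedin euclideanreal T"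
    have "closedin (subtopology X D) {x \<in> topspace (subtopology X D). d x \<in> T}"
      using d T unfolding continuous_map_closedin by blast
    then have "closedin X {x \<in> topspace (subtopology X D). d x \<in> T}"
      using \<open>closedin X D\<close> closedin_trans_full by blast
    moreover have "{x \<in> topspace (subtopology X D). d x \<in> T} = {x \<in> D. d x \<in> T}"
      using closedin_subset[OF \<open>closedin X D\<close>] by auto
    moreover have "{x \<in> topspace (subtopology X ?C). e x \<in> T}
        = {x \<in> D. d x \<in> T} \<union> (if 0 \<in> T then A else {}) \<union> (if 1 \<in> T then B else {})"
      using closedin_subset[OF C] e eA eB by auto
    ultimately have "closedin X {x \<in> topspace (subtopology X ?C). e x \<in> T}"
      using assms(3,4) by (auto intro!: closedin_Un)
    then show "closedin (subtopology X ?C) {x \<in> topspace (subtopology X ?C). e x \<in> T}"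
      by (rule closedin_subset_topspace) auto
  qed auto
  then obtain h where "continuous_map X euclideanreal h" "\<forall>x\<in>?C. h x = e x"
    using iffD1[OF normal_space_iff_Tietze \<open>normal_space X\<close>, rule_format, of ?C e] C by auto
  with that e eA eB show thesis by simp
qed

text \<open>Induction on the index set with \<open>C\<close> varying: a Urysohn function handles the
  part of \<open>C\<close> that only \<open>U j\<close> covers, and the other sets cover a closed
  remainder.\<close>

lemma exists_subordinate_functions_pos:
  fixes U :: "'i \<Rightarrow> 'a set"
  assumes "finite I" "normal_space X" "\<And>i. i \<in> I \<Longrightarrow> openin X (U i)"
    and "closedin X C" "C \<subseteq> (\<Union>i\<in>I. U i)"
  shows "\<exists>p :: 'a \<Rightarrow> 'i \<Rightarrow> real. (\<forall>i\<in>I. continuous_map X euclideanreal (\<lambda>x. p x i)) \<and>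
    (\<forall>x\<in>topspace X. \<forall>i\<in>I. 0 \<le> p x i \<and> (x \<notin> U i \<longrightarrow> p x i = 0)) \<and>
    (\<forall>x\<in>C. 0 < (\<Sum>i\<in>I. p x i))"
  using assms(1,3-)
proof (induction I arbitrary: C)
  case empty
  then show ?case by auto
next
  case (insert j I)
  let ?B = "C - (\<Union>i\<in>I. U i)"
  have "closedin X ?B"
    using insert.prems by (intro closedin_diff openin_Union) auto
  moreover have "closedin X (topspace X - U j)" using insert.prems by blast
  moreover have "disjnt (topspace X - U j) ?B" using insert.prems by (auto simp: disjnt_iff)
  ultimately obtain f0 where f0: "continuous_map X euclideanreal f0"
    "f0 ` (topspace X - U j) \<subseteq> {0}" "f0 ` ?B \<subseteq> {1}"
    using Urysohn_lemma_alt[OF \<open>normal_space X\<close>] by metis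
  \<comment> \<open>\<open>f0\<close> may be negative; truncation keeps both prescribed
    values.\<close>
  define f where "f x = max 0 (f0 x)" for x
  have f: "continuous_map X euclideanreal f"
    unfolding f_def by (intro continuous_intros f0)
  have f1: "f x = 0" if "x \<in> topspace X" "x \<notin> U j" for x
    using that f0 by (auto simp: f_def image_subset_iff)
  have f2: "f x = 1" if "x \<in> ?B" for x
    using that f0(3) by (auto simp: f_def image_subset_iff)
  \<comment> \<open>Points with \<open>f x > 1/2\<close> already have a positive sum. The condition
    \<open>f x \<le> 1/2\<close> keeps the remainder closed and excludes \<open>?B\<close>, where
    \<open>f\<close> is 1.\<close>
  let ?C = "{x \<in> topspace X. f x \<in> {..1/2}} \<inter> C"
  have "closedin X ?C"
    using insert.prems(2) closedin_continuous_map_preimage[OF f, of "{..1/2}"] by auto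
  moreover have "?C \<subseteq> (\<Union>i\<in>I. U i)"
    using f2 by force
  ultimately obtain p :: "'a \<Rightarrow> 'i \<Rightarrow> real" where p:
    "\<forall>i\<in>I. continuous_map X euclideanreal (\<lambda>x. p x i)"
    "\<forall>x\<in>topspace X. \<forall>i\<in>I. 0 \<le> p x i \<and> (x \<notin> U i \<longrightarrow> p x i = 0)"
    "\<forall>x\<in>?C. 0 < (\<Sum>i\<in>I. p x i)"
    using insert.IH[of ?C] insert.prems(1) by auto
  define q where "q x i = (if i = j then f x else p x i)" for x i
  have qI: "(\<Sum>i\<in>insert j I. q x i) = f x + (\<Sum>i\<in>I. p x i)" for x
    using insert.hyps by (auto simp: q_def intro!: sum.cong)
  have "0 < (\<Sum>i\<in>insert j I. q x i)" if "x \<in> C" for x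
  proof -
    have xX: "x \<in> topspace X" using that insert.prems(2) closedin_subset by blast
    have nn: "0 \<le> (\<Sum>i\<in>I. p x i)" using p(2) xX by (intro sum_nonneg) auto
    show ?thesis
    proof (cases "f x \<le> 1/2")
      case True
      then show ?thesis using p(3) that xX unfolding qI by (simp add: f_def add_nonneg_pos)
    qed (use nn qI in auto)
  qed
  moreover have "\<forall>i\<in>insert j I. continuous_map X euclideanreal (\<lambda>x. q x i)"
    using f p(1) by (auto simp: q_def)
  moreover have "\<forall>x\<in>topspace X. \<forall>i\<in>insert j I. 0 \<le> q x i \<and> (x \<notin> U i \<longrightarrow> q x i = 0)"
    using f1 p(2) by (auto simp: q_def f_def)
  ultimately show ?case by blast
qed

text \<open>A partition of unity indexed by \<open>I\<close> is seen as a map into the full simplex on \<open>I\<close>; the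
  bound \<open>N\<close> puts its values in the skeleton of dimension \<open>N - 1\<close>.\<close>

definition thin_partition ::
    "'a topology \<Rightarrow> 'a set \<Rightarrow> 'i set \<Rightarrow> ('i \<Rightarrow> 'a set) \<Rightarrow> nat \<Rightarrow> ('a \<Rightarrow> 'i \<Rightarrow> real) \<Rightarrow> bool" where
  "thin_partition X C I U N f \<longleftrightarrow>
     (\<forall>i\<in>I. continuous_map (subtopology X C) euclideanreal (\<lambda>x. f x i)) \<and>
     (\<forall>x\<in>C. (\<forall>i\<in>I. 0 \<le> f x i \<and> (x \<notin> U i \<longrightarrow> f x i = 0)) \<and>
       (\<Sum>i\<in>I. f x i) = 1 \<and> card {i \<in> I. 0 < f x i} \<le> N)"

text \<open>Extension into the full simplex, where the bound \<open>card I\<close> is no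
  restriction: extend the coordinates separately, fill up the deficit of their sum, and normalize.
  With \<open>A\<close> empty this gives existence.\<close>

lemma thin_partition_extend_full:
  fixes U :: "'i \<Rightarrow> 'a set"
  assumes "normal_space X" "finite I" "\<And>i. i \<in> I \<Longrightarrow> openin X (U i)" "topspace X \<subseteq> (\<Union>i\<in>I. U i)"
    and A: "closedin X A" and f: "thin_partition X A I U N f"
  obtains F where "thin_partition X (topspace X) I U (card I) F"
    "\<And>x i. x \<in> A \<Longrightarrow> i \<in> I \<Longrightarrow> F x i = f x i"
proof -
  have "\<exists>g. continuous_map X euclideanreal g \<and> (\<forall>x\<in>A. g x = f x i) \<and>
      (\<forall>x\<in>topspace X - U i. g x = 0)" if "i \<in> I" for i
  proof (rule continuous_map_extension_with_zeros_and_ones[of X A "topspace X - U i" "{}" "\<lambda>x. f x i"])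
    show "continuous_map (subtopology X A) euclideanreal (\<lambda>x. f x i)"
      using f that by (auto simp: thin_partition_def)
    show "f x i = 0" if "x \<in> A" "x \<in> topspace X - U i" for x
      using f that \<open>i \<in> I\<close> by (auto simp: thin_partition_def)
  qed (use assms that in auto)
  then obtain g where g: "continuous_map X euclideanreal (g i)" "\<forall>x\<in>A. g i x = f x i"
      "\<forall>x\<in>topspace X - U i. g i x = 0" if "i \<in> I" for i
    by metis
  obtain p :: "'a \<Rightarrow> 'i \<Rightarrow> real" where p:
    "\<forall>i\<in>I. continuous_map X euclideanreal (\<lambda>x. p x i)"
    "\<forall>x\<in>topspace X. \<forall>i\<in>I. 0 \<le> p x i \<and> (x \<notin> U i \<longrightarrow> p x i = 0)"
    "\<forall>x\<in>topspace X. 0 < (\<Sum>i\<in>I. p x i)"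
    using exists_subordinate_functions_pos[OF \<open>finite I\<close> \<open>normal_space X\<close>, of U "topspace X"] assms
    by auto
  define s where "s x = (\<Sum>i\<in>I. max 0 (g i x))" for x
  \<comment> \<open>On \<open>A\<close> the coordinates sum to 1, so the deficit
    \<open>1 - s x\<close> vanishes and \<open>f\<close> survives; where \<open>s\<close> is 0 the
    functions \<open>p\<close> keep the total positive, as the division in \<open>F\<close>
    requires.\<close>
  define H where "H x i = max 0 (g i x) + max 0 (1 - s x) * p x i" for x i
  define F where "F x i = H x i / (\<Sum>j\<in>I. H x j)" for x i
  have s0: "0 \<le> s x" for x unfolding s_def by (intro sum_nonneg) auto
  have Hsum: "(\<Sum>j\<in>I. H x j) = s x + max 0 (1 - s x) * (\<Sum>j\<in>I. p x j)" for x
    by (simp add: H_def s_def sum.distrib sum_distrib_left)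
  have Hpos: "0 < (\<Sum>j\<in>I. H x j)" if "x \<in> topspace X" for x
  proof (cases "s x = 0")
    case True
    then show ?thesis using p(3) that by (simp add: Hsum)
  next
    case False
    then have "0 < s x" using s0[of x] by simp
    moreover have "0 \<le> max 0 (1 - s x) * (\<Sum>j\<in>I. p x j)"
      using p(3) that by (intro mult_nonneg_nonneg) (auto intro: less_imp_le)
    ultimately show ?thesis unfolding Hsum by linarith
  qed
  have H0: "0 \<le> H x i" if "x \<in> topspace X" "i \<in> I" for x i
    using p(2) that by (auto simp: H_def intro!: add_nonneg_nonneg mult_nonneg_nonneg)
  have cs: "continuous_map X euclideanreal s"
    unfolding s_def using g(1) \<open>finite I\<close> by (intro continuous_intros) auto
  have cH: "continuous_map X euclideanreal (\<lambda>x. H x i)" if "i \<in> I" for i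
    unfolding H_def using g(1)[OF that] p(1) that cs by (intro continuous_intros) auto
  have cF: "continuous_map X euclideanreal (\<lambda>x. F x i)" if "i \<in> I" for i
    unfolding F_def using cH \<open>finite I\<close> that Hpos by (intro continuous_intros) force+
  show thesis
  proof
    have "(\<Sum>i\<in>I. F x i) = 1" if "x \<in> topspace X" for x
      using Hpos[OF that] by (simp add: F_def flip: sum_divide_distrib)
    moreover have "0 \<le> F x i" if "x \<in> topspace X" "i \<in> I" for x i
      using Hpos H0 that by (simp add: F_def less_imp_le)
    moreover have "F x i = 0" if "x \<in> topspace X" "i \<in> I" "x \<notin> U i" for x i
      using g(3) p(2) that by (simp add: F_def H_def)
    ultimately show "thin_partition X (topspace X) I U (card I) F"
      using cF \<open>finite I\<close> by (auto simp: thin_partition_def intro!: card_mono)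
    fix x i assume "x \<in> A" "i \<in> I"
    have g': "max 0 (g j x) = f x j" if "j \<in> I" for j
      using g(2) that f \<open>x \<in> A\<close> by (auto simp: thin_partition_def)
    have "s x = 1"
      using f \<open>x \<in> A\<close> by (simp add: s_def g' thin_partition_def)
    then have "(\<Sum>j\<in>I. H x j) = 1" by (simp add: Hsum)
    then show "F x i = f x i" using g' \<open>i \<in> I\<close> \<open>s x = 1\<close> by (simp add: F_def H_def)
  qed
qed

section \<open>Order statistics of finitely many coordinates\<close>

lemma continuous_map_Max:
  fixes f :: "'i \<Rightarrow> 'a \<Rightarrow> real"
  assumes "finite J" "J \<noteq> {}" "\<And>j. j \<in> J \<Longrightarrow> continuous_map X euclideanreal (f j)"
  shows "continuous_map X euclideanreal (\<lambda>x. Max ((\<lambda>j. f j x) ` J))"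
  using assms by (induction J rule: finite_ne_induct) (auto intro!: continuous_intros)

lemma continuous_map_Min:
  fixes f :: "'i \<Rightarrow> 'a \<Rightarrow> real"
  assumes "finite J" "J \<noteq> {}" "\<And>j. j \<in> J \<Longrightarrow> continuous_map X euclideanreal (f j)"
  shows "continuous_map X euclideanreal (\<lambda>x. Min ((\<lambda>j. f j x) ` J))"
  using assms by (induction J rule: finite_ne_induct) (auto intro!: continuous_intros)

text \<open>The \<open>(N + 1)\<close>-st largest of the values \<open>v i\<close>, for nonnegative \<open>v\<close>; it is \<open>0\<close> if
  \<open>card I \<le> N\<close>.\<close>

definition ranked_value :: "nat \<Rightarrow> 'i set \<Rightarrow> ('i \<Rightarrow> real) \<Rightarrow> real" where
  "ranked_value N I v = Max (insert 0 ((\<lambda>J. Min (v ` J)) ` {J. J \<subseteq> I \<and> card J = Suc N}))"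

lemma continuous_map_ranked_value:
  assumes "finite I" "\<And>i. i \<in> I \<Longrightarrow> continuous_map X euclideanreal (\<lambda>x. v x i)"
  shows "continuous_map X euclideanreal (\<lambda>x. ranked_value N I (v x))"
proof -
  let ?K = "{J. J \<subseteq> I \<and> card J = Suc N}"
  have fin: "finite ?K" using assms(1) by simp
  have "continuous_map X euclideanreal (\<lambda>x. Min (v x ` J))" if "J \<in> ?K" for J
  proof (rule continuous_map_Min)
    show "finite J" "J \<noteq> {}" using that by (auto intro: card_ge_0_finite)
  qed (use that assms in auto)
  then have "continuous_map X euclideanreal (\<lambda>x. max 0 (Max ((\<lambda>J. Min (v x ` J)) ` ?K)))" if "?K \<noteq> {}"
    using continuous_map_Max[OF fin that, of X "\<lambda>J x. Min (v x ` J)"]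
    by (intro continuous_intros) auto
  moreover have "ranked_value N I (v x) = (if ?K = {} then 0 else max 0 (Max ((\<lambda>J. Min (v x ` J)) ` ?K)))" for x
    unfolding ranked_value_def using fin
    by (cases "?K = {}") (simp_all only: if_True if_False image_empty Max_singleton Max_insert
      finite_imageI image_is_empty simp_thms)
  ultimately show ?thesis by (cases "?K = {}") (simp_all only: if_True if_False, simp_all)
qed

lemma ranked_value_nonneg: "finite I \<Longrightarrow> 0 \<le> ranked_value N I v"
  unfolding ranked_value_def by (rule Max_ge) auto

text \<open>If \<open>N + 1\<close> values exceeded the ranked value, their minimum would too, but
  that minimum is a candidate in the maximum.\<close>

lemma card_above_ranked_value:
  assumes "finite I"
  shows "card {i \<in> I. ranked_value N I v < v i} \<le> N"
proof (rule ccontr)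
  assume "\<not> ?thesis"
  then obtain J where J: "J \<subseteq> {i \<in> I. ranked_value N I v < v i}" "card J = Suc N"
    by (meson not_less_eq_eq obtain_subset_with_card_n)
  have "finite J" "J \<noteq> {}" using J by (auto intro: card_ge_0_finite)
  then have "ranked_value N I v < Min (v ` J)" using J(1) by auto
  moreover have "Min (v ` J) \<le> ranked_value N I v"
    unfolding ranked_value_def using J assms by (intro Max_ge) auto
  ultimately show False by simp
qed

lemma ranked_value_less:
  assumes "finite I" "0 < c" "card {i \<in> I. c \<le> v i} \<le> N"
  shows "ranked_value N I v < c"
proof -
  have "Min (v ` J) < c" if J: "J \<subseteq> I" "card J = Suc N" for J
  proof -
    have fJ: "finite J" "J \<noteq> {}" using J by (auto intro: card_ge_0_finite)
    have "\<not> J \<subseteq> {i \<in> I. c \<le> v i}"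
      using assms J card_mono[of "{i \<in> I. c \<le> v i}" J] by auto
    then have "\<exists>j\<in>J. v j < c" using J by force
    then show ?thesis using fJ by (auto simp: Min_less_iff)
  qed
  then show ?thesis unfolding ranked_value_def using assms by auto
qed

lemma ranked_value_eq_0:
  assumes "finite I" "card {i \<in> I. 0 < v i} \<le> N"
  shows "ranked_value N I v = 0"
proof -
  have "ranked_value N I v < c" if "0 < c" for c
    using that assms
    by (intro ranked_value_less) (auto intro: order.trans[OF card_mono assms(2)])
  \<comment> \<open>A positive ranked value would be less than itself.\<close>
  from this[of "ranked_value N I v"] show ?thesis
    using ranked_value_nonneg[OF assms(1), of N v] by linarith
qed

lemma card_above_less:
  assumes "finite I" "ranked_value N I v < c"
  shows "card {i \<in> I. c \<le> v i} \<le> N"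
  using assms by (intro order.trans[OF card_mono card_above_ranked_value[of I N v]]) auto

section \<open>Thin partitions from the dimension bound\<close>

text \<open>The members of a refinement are merged according to a chosen \<open>U i\<close>
  containing them, which keeps the index set \<open>I\<close>. Coordinates positive at
  \<open>x\<close> then come from different members of the refinement containing \<open>x\<close>,
  so there are at most \<open>N\<close> of them.\<close>

lemma covering_dim_le_thin_partition:
  fixes U :: "'i \<Rightarrow> 'a set"
  assumes "normal_space X" "covering_dim_le X (int N - 1)" "finite I"
    and "\<And>i. i \<in> I \<Longrightarrow> openin X (U i)" "topspace X \<subseteq> (\<Union>i\<in>I. U i)"
  obtains h where "thin_partition X (topspace X) I U N h"
proof -
  have "open_cover X (U ` I)"
    using assms(4,5) openin_subset by (fastforce simp: open_cover_def)
  then obtain \<V> where \<V>: "finite \<V>" "open_cover X \<V>" "\<forall>V\<in>\<V>. \<exists>W\<in>U ` I. V \<subseteq> W"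
    "\<forall>x\<in>topspace X. int (card {V \<in> \<V>. x \<in> V}) \<le> int N - 1 + 1"
    using assms(2)[unfolded covering_dim_le_def, rule_format, of "U ` I"] assms(3) by auto
  then have "\<forall>V\<in>\<V>. \<exists>i. i \<in> I \<and> V \<subseteq> U i" by auto
  then obtain c where c: "\<And>V. V \<in> \<V> \<Longrightarrow> c V \<in> I \<and> V \<subseteq> U (c V)"
    using bchoice by metis
  define W where "W i = \<Union>{V \<in> \<V>. c V = i}" for i
  have "openin X (W i)" for i
    using \<V>(2) unfolding W_def open_cover_def by (intro openin_Union) auto
  moreover have "topspace X \<subseteq> (\<Union>i\<in>I. W i)"
  proof
    fix x assume "x \<in> topspace X"
    then obtain V where "V \<in> \<V>" "x \<in> V" using \<V>(2) by (auto simp: open_cover_def)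
    then have "c V \<in> I" "x \<in> W (c V)" using c by (auto simp: W_def)
    then show "x \<in> (\<Union>i\<in>I. W i)" by blast
  qed
  \<comment> \<open>On the empty set the zero family qualifies vacuously; extending it yields a
    partition of unity subordinate to \<open>W\<close>.\<close>
  moreover have "thin_partition X {} I W 0 (\<lambda>x i. 0)"
    by (simp add: thin_partition_def)
  ultimately obtain h where h: "thin_partition X (topspace X) I W (card I) h"
    using thin_partition_extend_full[OF assms(1,3), of W "{}" 0 "\<lambda>x i. 0"] by auto
  have "card {i \<in> I. 0 < h x i} \<le> N" if x: "x \<in> topspace X" for x
  proof -
    have "{i \<in> I. 0 < h x i} \<subseteq> c ` {V \<in> \<V>. x \<in> V}"
      using h x by (force simp: thin_partition_def W_def)
    then have "card {i \<in> I. 0 < h x i} \<le> card {V \<in> \<V>. x \<in> V}"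
      using \<V>(1) by (auto intro: surj_card_le)
    then show ?thesis using \<V>(4) x by force
  qed
  moreover have "x \<notin> W i" if "x \<notin> U i" for x i using c that by (auto simp: W_def)
  ultimately have "thin_partition X (topspace X) I U N h"
    using h by (auto simp: thin_partition_def)
  then show thesis by (rule that)
qed

text \<open>In the \<open>(N - 1)\<close>-skeleton, \<open>F\<close> and \<open>h\<close> are connected by a straight line wherever their
  joint support has at most \<open>N\<close> elements, and in particular on \<open>A\<close>.  So follow this line from
  \<open>F\<close> on \<open>A\<close> to \<open>h\<close> away from \<open>A\<close>, and push the result into the skeleton by subtracting from
  all coordinates the \<open>(N + 1)\<close>-st largest one.\<close>

theorem thin_partition_extend:
  fixes U :: "'i \<Rightarrow> 'a set"
  assumes X: "normal_space X" and dim: "covering_dim_le X (int N - 1)" and "finite I"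
    and "\<And>i. i \<in> I \<Longrightarrow> openin X (U i)" "topspace X \<subseteq> (\<Union>i\<in>I. U i)"
    and A: "closedin X A" and f: "thin_partition X A I U N f"
  obtains g where "thin_partition X (topspace X) I U N g"
    "\<And>x i. x \<in> A \<Longrightarrow> i \<in> I \<Longrightarrow> g x i = f x i"
proof -
  obtain F where F: "thin_partition X (topspace X) I U (card I) F"
    and Ff: "\<And>x i. x \<in> A \<Longrightarrow> i \<in> I \<Longrightarrow> F x i = f x i"
    using thin_partition_extend_full[OF X \<open>finite I\<close> assms(4) assms(5) A f] by blast
  have cF: "continuous_map X euclideanreal (\<lambda>x. F x i)" if "i \<in> I" for i
    using F that by (auto simp: thin_partition_def)
  have F0: "0 \<le> F x i" if "x \<in> topspace X" "i \<in> I" for x i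
    using F that by (auto simp: thin_partition_def)
  have F1: "(\<Sum>i\<in>I. F x i) = 1" if "x \<in> topspace X" for x
    using F that by (auto simp: thin_partition_def)
  \<comment> \<open>Subordinating \<open>h\<close> to these sets forces its support into that of
    \<open>F\<close>. Hence the later functions still vanish off \<open>U i\<close>, and on
    \<open>A\<close> the joint support is that of \<open>f\<close>.\<close>
  define V where "V i = {x \<in> topspace X. F x i \<in> {0<..}}" for i
  have "openin X (V i)" if "i \<in> I" for i
    unfolding V_def using cF[OF that] by (rule openin_continuous_map_preimage) auto
  moreover have "topspace X \<subseteq> (\<Union>i\<in>I. V i)"
  proof
    fix x assume x: "x \<in> topspace X"
    then have "\<exists>i\<in>I. F x i \<noteq> 0" using F1[OF x] by (metis sum.neutral zero_neq_one)
    then show "x \<in> (\<Union>i\<in>I. V i)" using F0[OF x] x by (fastforce simp: V_def)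
  qed
  ultimately obtain h where h: "thin_partition X (topspace X) I V N h"
    using covering_dim_le_thin_partition[OF X dim \<open>finite I\<close>, of V] by blast
  have ch: "continuous_map X euclideanreal (\<lambda>x. h x i)" if "i \<in> I" for i
    using h that by (auto simp: thin_partition_def)
  have h1: "(\<Sum>i\<in>I. h x i) = 1" if "x \<in> topspace X" for x
    using h that by (auto simp: thin_partition_def)
  have hN: "card {i\<in>I. 0 < h x i} \<le> N" if "x \<in> topspace X" for x
    using h that by (auto simp: thin_partition_def)
  have hF: "h x i = 0" if "x \<in> topspace X" "i \<in> I" "F x i = 0" for x i
    using h that by (auto simp: thin_partition_def V_def)
  \<comment> \<open>Some coordinate of \<open>G x\<close> is at least \<open>1 / k\<close>, as they
    sum to 1. If \<open>q x \<ge> 1 / k\<close>, then \<open>t x = 1\<close> and \<open>G x\<close>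
    is \<open>h x\<close>, so \<open>m x = 0\<close>; otherwise
    \<open>G x i \<le> max (F x i) (h x i)\<close> gives \<open>m x < 1 / k\<close>. Either way
    something positive remains after subtracting \<open>m x\<close>. On \<open>A\<close>,
    \<open>q\<close> vanishes and \<open>G\<close> is \<open>F\<close>.\<close>
  define k where "k = real (card I)"
  define q where "q x = ranked_value N I (\<lambda>i. max (F x i) (h x i))" for x
  define t where "t x = min 1 (k * q x)" for x
  define G where "G x i = (1 - t x) * F x i + t x * h x i" for x i
  define m where "m x = ranked_value N I (G x)" for x
  define P where "P x i = max 0 (G x i - m x)" for x i
  define g where "g x i = P x i / (\<Sum>j\<in>I. P x j)" for x i
  have q0: "0 \<le> q x" for x unfolding q_def by (rule ranked_value_nonneg[OF \<open>finite I\<close>])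
  have t01: "0 \<le> t x" "t x \<le> 1" for x using q0 by (auto simp: t_def k_def)
  have cq: "continuous_map X euclideanreal q"
    unfolding q_def using \<open>finite I\<close> cF ch
    by (intro continuous_map_ranked_value continuous_intros) auto
  have ct: "continuous_map X euclideanreal t"
    unfolding t_def using cq by (intro continuous_intros) auto
  have cG: "continuous_map X euclideanreal (\<lambda>x. G x i)" if "i \<in> I" for i
    unfolding G_def using ct cF[OF that] ch[OF that] by (intro continuous_intros)
  have cm: "continuous_map X euclideanreal m"
    unfolding m_def using \<open>finite I\<close> cG by (intro continuous_map_ranked_value) auto
  have cP: "continuous_map X euclideanreal (\<lambda>x. P x i)" if "i \<in> I" for i
    unfolding P_def using cm cG[OF that] by (intro continuous_intros) auto
  have G1: "(\<Sum>i\<in>I. G x i) = 1" if "x \<in> topspace X" for x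
    using F1[OF that] h1[OF that] by (simp add: G_def sum.distrib flip: sum_distrib_left)
  have GF: "G x i = 0" if "x \<in> topspace X" "i \<in> I" "F x i = 0" for x i
    using hF[OF that] that by (simp add: G_def)
  have m0: "0 \<le> m x" for x
    unfolding m_def by (rule ranked_value_nonneg[OF \<open>finite I\<close>])
  have Ppos: "0 < (\<Sum>j\<in>I. P x j)" if x: "x \<in> topspace X" for x
  proof -
    have "I \<noteq> {}" using F1[OF x] by auto
    then have kpos: "0 < k" using \<open>finite I\<close> by (simp add: k_def card_gt_0_iff)
    have "m x < 1 / k"
    proof (cases "q x < 1 / k")
      case True
      have "G x i \<le> max (F x i) (h x i)" for i
        unfolding G_def using t01[of x] convex_bound_le[of "F x i" "max (F x i) (h x i)" "h x i" "1 - t x" "t x"]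
        by simp
      then have "card {i \<in> I. 1 / k \<le> G x i} \<le> card {i \<in> I. 1 / k \<le> max (F x i) (h x i)}"
        using \<open>finite I\<close> by (intro card_mono) (auto intro: order.trans)
      also have "\<dots> \<le> N" using True unfolding q_def by (rule card_above_less[OF \<open>finite I\<close>])
      finally show ?thesis unfolding m_def using kpos \<open>finite I\<close> by (intro ranked_value_less) auto
    next
      case False
      then have "t x = 1" using kpos by (simp add: t_def field_simps)
      then have "m x = 0" unfolding m_def using hN[OF x] \<open>finite I\<close>
        by (intro ranked_value_eq_0) (auto simp: G_def)
      then show ?thesis using kpos by simp
    qed
    moreover have "\<exists>i\<in>I. 1 / k \<le> G x i"
    proof (rule ccontr)
      assume "\<not> ?thesis"
      then have "(\<Sum>i\<in>I. G x i) < (\<Sum>i\<in>I. 1 / k)"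
        using \<open>finite I\<close> \<open>I \<noteq> {}\<close> by (intro sum_strict_mono) auto
      then show False using G1[OF x] kpos by (simp add: k_def)
    qed
    ultimately obtain i where "i \<in> I" "0 < P x i" unfolding P_def by force
    then show ?thesis using \<open>finite I\<close> by (intro sum_pos2) (auto simp: P_def)
  qed
  have cg: "continuous_map X euclideanreal (\<lambda>x. g x i)" if "i \<in> I" for i
    unfolding g_def using cP \<open>finite I\<close> that Ppos by (intro continuous_intros) force+
  show thesis
  proof
    have "(\<Sum>i\<in>I. g x i) = 1" if "x \<in> topspace X" for x
      using Ppos[OF that] by (simp add: g_def flip: sum_divide_distrib)
    moreover have "0 \<le> g x i" if "x \<in> topspace X" for x i
      using Ppos[OF that] by (simp add: g_def P_def)
    moreover have "g x i = 0" if "x \<in> topspace X" "i \<in> I" "x \<notin> U i" for x i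
    proof -
      have "F x i = 0" using F that by (auto simp: thin_partition_def)
      then show ?thesis using GF[of x i] that m0[of x] by (simp add: g_def P_def)
    qed
    moreover have "card {i \<in> I. 0 < g x i} \<le> N" if "x \<in> topspace X" for x
    proof -
      have "{i \<in> I. 0 < g x i} \<subseteq> {i \<in> I. m x < G x i}"
        using Ppos[OF that] by (auto simp: g_def P_def zero_less_divide_iff)
      then show ?thesis
        using order.trans[OF card_mono card_above_ranked_value[OF \<open>finite I\<close>, of N "G x"]] \<open>finite I\<close>
        unfolding m_def by auto
    qed
    ultimately show "thin_partition X (topspace X) I U N g"
      using cg by (auto simp: thin_partition_def)
    fix x i assume x: "x \<in> A" and i: "i \<in> I"
    then have xX: "x \<in> topspace X" using A closedin_subset by blast
    have FN: "card {i \<in> I. 0 < F x i} \<le> N"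
      using f x Ff by (auto simp: thin_partition_def cong: conj_cong)
    have "{i \<in> I. 0 < max (F x i) (h x i)} \<subseteq> {i \<in> I. 0 < F x i}"
      using hF[OF xX] F0[OF xX] by (force simp: less_max_iff_disj)
    then have "card {i \<in> I. 0 < max (F x i) (h x i)} \<le> N"
      using order.trans[OF card_mono FN] \<open>finite I\<close> by auto
    then have "t x = 0"
      unfolding t_def q_def using \<open>finite I\<close> by (simp add: ranked_value_eq_0)
    then have G: "G x = F x" by (auto simp: G_def)
    then have "m x = 0" unfolding m_def using FN \<open>finite I\<close> by (simp add: ranked_value_eq_0)
    then have "P x j = F x j" if "j \<in> I" for j using F0[OF xX that] G by (simp add: P_def)
    then show "g x i = f x i" using i F1[OF xX] Ff[OF x i] by (simp add: g_def)
  qed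
qed


section \<open>Spaces glued along words\<close>

text \<open>Dependent choice along the prefix tree: the choice for \<open>w @ [g]\<close> must fit
  the one already made for \<open>w\<close>, so a single recursion makes them all.\<close>

lemma choose_along_words:
  assumes "\<exists>h. Q [] h"
    and "\<And>w g h. w @ [g] \<in> W \<Longrightarrow> Q w h \<Longrightarrow> \<exists>h'. Q (w @ [g]) h' \<and> E g h h'"
    and W: "\<And>w g. w @ [g] \<in> W \<Longrightarrow> w \<in> W"
  shows "\<exists>F. (\<forall>w\<in>W. Q w (F w)) \<and> (\<forall>w g. w @ [g] \<in> W \<longrightarrow> E g (F w) (F (w @ [g])))"
proof -
  \<comment> \<open>Words grow at the right end while \<open>rec_list\<close> recurses from the
    left, hence the two uses of \<open>rev\<close>.\<close>
  define F where "F w = rec_list (SOME h. Q [] h)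
    (\<lambda>g ws h. SOME h'. Q (rev (g # ws)) h' \<and> E g h h') (rev w)" for w
  have F_snoc: "F (w @ [g]) = (SOME h'. Q (w @ [g]) h' \<and> E g (F w) h')" for w g
    by (simp add: F_def)
  have Q: "Q w (F w)" if "w \<in> W" for w
    using that
  proof (induction w rule: rev_induct)
    case Nil
    then show ?case using assms(1) by (auto simp: F_def intro: someI)
  next
    case (snoc g w)
    then show ?case using someI_ex[OF assms(2), of w g "F w"] W by (auto simp: F_snoc)
  qed
  moreover have "E g (F w) (F (w @ [g]))" if "w @ [g] \<in> W" for w g
    using someI_ex[OF assms(2), of w g "F w"] W that Q by (auto simp: F_snoc)
  ultimately show ?thesis by blast
qed

text \<open>\<open>Y\<close> is the colimit of copies \<open>i w ` X\<close> of \<open>X\<close>, one for each word \<open>w \<in> W\<close>, in which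
  the copy for \<open>w @ [g]\<close> is attached to the one for \<open>w\<close> by the map \<open>a g\<close> on the closed set \<open>D g\<close>.\<close>

locale word_atlas =
  fixes X :: "'x topology" and Y :: "'y topology" and W :: "'g list set"
    and D :: "'g \<Rightarrow> 'x set" and a :: "'g \<Rightarrow> 'x \<Rightarrow> 'x" and i :: "'g list \<Rightarrow> 'x \<Rightarrow> 'y"
  assumes Nil_W: "[] \<in> W"
    and prefix_W: "w @ [g] \<in> W \<Longrightarrow> w \<in> W"
    and closed_D: "w @ [g] \<in> W \<Longrightarrow> closedin X (D g)"
    and continuous_a: "w @ [g] \<in> W \<Longrightarrow> continuous_map (subtopology X (D g)) X (a g)"
    and topspace_Y: "topspace Y = (\<Union>w\<in>W. i w ` topspace X)"
    and openin_Y: "openin Y U \<longleftrightarrow>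
      U \<subseteq> topspace Y \<and> (\<forall>w\<in>W. openin X {x \<in> topspace X. i w x \<in> U})"
    and attach: "w @ [g] \<in> W \<Longrightarrow> x \<in> D g \<Longrightarrow> i (w @ [g]) x = i w (a g x)"
    and reduced_unique: "\<lbrakk>w \<in> W; w' \<in> W; x \<in> topspace X; x' \<in> topspace X;
      w = [] \<or> x \<notin> D (last w); w' = [] \<or> x' \<notin> D (last w'); i w x = i w' x'\<rbrakk> \<Longrightarrow> w = w' \<and> x = x'"
begin

lemma D_subset: "w @ [g] \<in> W \<Longrightarrow> D g \<subseteq> topspace X"
  using closed_D closedin_subset by blast

lemma a_in: "w @ [g] \<in> W \<Longrightarrow> x \<in> D g \<Longrightarrow> a g x \<in> topspace X"
  using continuous_a[of w g] D_subset[of w g] unfolding continuous_map_def by auto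

lemma i_in: "w \<in> W \<Longrightarrow> x \<in> topspace X \<Longrightarrow> i w x \<in> topspace Y"
  using topspace_Y by blast

text \<open>These pairs are the normal forms: each point of \<open>Y\<close> is \<open>i w x\<close>
  for exactly one of them, found by peeling off letters and unique by
  \<open>reduced_unique\<close>.\<close>

definition reduced :: "'g list \<Rightarrow> 'x \<Rightarrow> bool" where
  "reduced w x \<longleftrightarrow> w \<in> W \<and> x \<in> topspace X \<and> (w = [] \<or> x \<notin> D (last w))"

lemma reduced_inj: "reduced w x \<Longrightarrow> reduced w' x' \<Longrightarrow> i w x = i w' x' \<Longrightarrow> w = w' \<and> x = x'"
  unfolding reduced_def using reduced_unique by blast

text \<open>A pair that is not reduced ends in a letter \<open>g\<close> with the point in
  \<open>D g\<close>, so it can be peeled to a shorter word for the same point of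
  \<open>Y\<close>.\<close>

lemma atlas_induct [consumes 2, case_names reduced peel]:
  assumes "w \<in> W" "x \<in> topspace X"
    and "\<And>w x. reduced w x \<Longrightarrow> P w x"
    and "\<And>w g x. w @ [g] \<in> W \<Longrightarrow> x \<in> D g \<Longrightarrow> P w (a g x) \<Longrightarrow> P (w @ [g]) x"
  shows "P w x"
  using assms(1,2)
proof (induction w arbitrary: x rule: rev_induct)
  case Nil
  then show ?case using assms(3) by (simp add: reduced_def)
next
  case (snoc g w)
  show ?case
  proof (cases "x \<in> D g")
    case True
    then show ?thesis using snoc assms(4) prefix_W a_in by blast
  next
    case False
    then show ?thesis using snoc assms(3) by (simp add: reduced_def)
  qed
qed

text \<open>\<open>Q\<close> is the property wanted on each copy. It is kept abstract so that one
  gluing argument serves both Urysohn functions and thin partitions.\<close>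

lemma extend_to_atlas:
  assumes "\<exists>h. Q [] h"
    and "\<And>w g h. w @ [g] \<in> W \<Longrightarrow> Q w h \<Longrightarrow> \<exists>h'. Q (w @ [g]) h' \<and> (\<forall>x\<in>D g. h' x = h (a g x))"
  obtains \<phi> where "\<And>w. w \<in> W \<Longrightarrow> \<exists>h. Q w h \<and> (\<forall>x\<in>topspace X. \<phi> (i w x) = h x)"
proof -
  have "\<exists>F. (\<forall>w\<in>W. Q w (F w)) \<and> (\<forall>w g. w @ [g] \<in> W \<longrightarrow> (\<forall>x\<in>D g. F (w @ [g]) x = F w (a g x)))"
    by (rule choose_along_words) (use assms prefix_W in blast)+
  then obtain F where F: "\<And>w. w \<in> W \<Longrightarrow> Q w (F w)"
    and F_snoc: "\<And>w g. w @ [g] \<in> W \<Longrightarrow> \<forall>x\<in>D g. F (w @ [g]) x = F w (a g x)"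
    by auto
  \<comment> \<open>On reduced pairs there is no ambiguity; compatibility of \<open>F\<close> with
    \<open>a g\<close> then gives the formula on all pairs.\<close>
  define \<phi> where "\<phi> y = (THE z. \<exists>w x. reduced w x \<and> i w x = y \<and> z = F w x)" for y
  have \<phi>: "\<phi> (i w x) = F w x" if "w \<in> W" "x \<in> topspace X" for w x
    using that
  proof (induction rule: atlas_induct)
    case (reduced w x)
    then show ?case unfolding \<phi>_def by (intro the_equality) (use reduced_inj in blast)+
  next
    case (peel w g x)
    then show ?case using F_snoc by (simp add: attach)
  qed
  show thesis by (rule that[of \<phi>]) (use F \<phi> in blast)
qed

lemma closedin_Y:
  "closedin Y C \<longleftrightarrow> C \<subseteq> topspace Y \<and> (\<forall>w\<in>W. closedin X {x \<in> topspace X. i w x \<in> C})"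
proof -
  have "{x \<in> topspace X. i w x \<in> topspace Y - C} = topspace X - {x \<in> topspace X. i w x \<in> C}"
    if "w \<in> W" for w
    using that i_in by auto
  then show ?thesis by (auto simp: closedin_def openin_Y)
qed

text \<open>Induction on words: the preimage of \<open>C\<close> in the copy for
  \<open>w @ [g]\<close> is its reduced part together with the pullback along \<open>a g\<close> of
  the preimage in the copy for \<open>w\<close>. That pullback is closed in \<open>D g\<close>,
  hence in \<open>X\<close>.\<close>

lemma closedin_Y_reduced:
  assumes "C \<subseteq> topspace Y" "\<And>w. w \<in> W \<Longrightarrow> closedin X {x. reduced w x \<and> i w x \<in> C}"
  shows "closedin Y C"
proof -
  have "closedin X {x \<in> topspace X. i w x \<in> C}" if "w \<in> W" for w
    using that
  proof (induction w rule: rev_induct)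
    case Nil
    then show ?case using assms(2)[of "[]"] by (simp add: reduced_def)
  next
    case (snoc g w)
    have "closedin (subtopology X (D g))
        {x \<in> topspace (subtopology X (D g)). a g x \<in> {x \<in> topspace X. i w x \<in> C}}"
      using snoc prefix_W continuous_a by (intro closedin_continuous_map_preimage) blast+
    then have "closedin X
        {x \<in> topspace (subtopology X (D g)). a g x \<in> {x \<in> topspace X. i w x \<in> C}}"
      using closedin_trans_full closed_D snoc.prems by blast
    moreover have "{x \<in> topspace X. i (w @ [g]) x \<in> C} = {x. reduced (w @ [g]) x \<and> i (w @ [g]) x \<in> C} \<union>
        {x \<in> topspace (subtopology X (D g)). a g x \<in> {x \<in> topspace X. i w x \<in> C}}"
      using snoc.prems D_subset[of w g] a_in[of w g] by (auto simp: reduced_def attach)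
    ultimately show ?case using assms(2)[OF snoc.prems] by (simp only: closedin_Un)
  qed
  then show ?thesis using assms(1) by (simp add: closedin_Y)
qed

lemma continuous_map_i: "w \<in> W \<Longrightarrow> continuous_map X Y (i w)"
  using i_in by (auto simp: continuous_map_def openin_Y)

lemma continuous_map_from_Y:
  assumes "\<And>w. w \<in> W \<Longrightarrow> continuous_map X Z (\<lambda>x. f (i w x))"
  shows "continuous_map Y Z f"
  unfolding continuous_map_def
proof (intro conjI allI impI)
  show "f \<in> topspace Y \<rightarrow> topspace Z"
    using assms unfolding topspace_Y continuous_map_def by blast
  fix T assume "openin Z T"
  have "openin X {x \<in> topspace X. i w x \<in> {y \<in> topspace Y. f y \<in> T}}" if "w \<in> W" for w
  proof -
    have "{x \<in> topspace X. i w x \<in> {y \<in> topspace Y. f y \<in> T}} = {x \<in> topspace X. f (i w x) \<in> T}"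
      using i_in that by auto
    then show ?thesis using assms that \<open>openin Z T\<close> by (simp add: continuous_map_def)
  qed
  then show "openin Y {y \<in> topspace Y. f y \<in> T}" by (auto simp: openin_Y)
qed

section \<open>Separation axioms for the glued space\<close>

text \<open>A point has only one reduced pair, so its reduced part in any copy is empty or a
  singleton.\<close>

theorem t1_space_Y:
  assumes "t1_space X"
  shows "t1_space Y"
  unfolding t1_space_closedin_singleton
proof (intro ballI closedin_Y_reduced)
  fix y w assume "y \<in> topspace Y" "w \<in> W"
  show "closedin X {x. reduced w x \<and> i w x \<in> {y}}"
  proof (cases "\<exists>x. reduced w x \<and> i w x = y")
    case True
    then obtain x where "reduced w x" "i w x = y" by blast
    then have "{x. reduced w x \<and> i w x \<in> {y}} = {x}" using reduced_inj by auto
    then show ?thesis using assms \<open>reduced w x\<close>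
      by (simp add: t1_space_closedin_singleton reduced_def)
  next
    case False
    then have "{x. reduced w x \<and> i w x \<in> {y}} = {}" by blast
    then show ?thesis by (simp only: closedin_empty)
  qed
qed auto

text \<open>Urysohn functions are glued copy by copy. The values forced on \<open>D g\<close> by the
  previous copy respect 0 on \<open>A\<close> and 1 on \<open>B\<close>, since by
  \<open>attach\<close> both pairs name the same point of \<open>Y\<close>.\<close>

theorem normal_space_Y:
  assumes X: "normal_space X"
  shows "normal_space Y"
  unfolding normal_space_iff_Urysohn_alt
proof (intro allI impI, elim conjE)
  fix A B assume AB: "closedin Y A" "closedin Y B" "disjnt A B"
  define A' B' where "A' w = {x \<in> topspace X. i w x \<in> A}" and "B' w = {x \<in> topspace X. i w x \<in> B}" for w
  have cl: "closedin X (A' w)" "closedin X (B' w)" "disjnt (A' w) (B' w)" if "w \<in> W" for w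
    using AB that by (auto simp: A'_def B'_def closedin_Y disjnt_iff)
  define Q where "Q w h \<longleftrightarrow> continuous_map X euclideanreal h \<and>
    (\<forall>x\<in>A' w. h x = 0) \<and> (\<forall>x\<in>B' w. h x = 1)" for w h
  \<comment> \<open>No earlier copy prescribes values, so the function is extended from the empty
    set.\<close>
  have base: "\<exists>h. Q [] h"
    unfolding Q_def
    using continuous_map_extension_with_zeros_and_ones[OF X, of "{}" "A' []" "B' []" "\<lambda>x. 0"] cl Nil_W
    by (metis closedin_empty continuous_map_const empty_iff topspace_euclidean UNIV_I)
  have step: "\<exists>h'. Q (w @ [g]) h' \<and> (\<forall>x\<in>D g. h' x = h (a g x))"
    if w: "w @ [g] \<in> W" and h: "Q w h" for w g h
  proof (rule continuous_map_extension_with_zeros_and_ones[OF X, of "D g" "A' (w @ [g])" "B' (w @ [g])" "\<lambda>x. h (a g x)"])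
    show "continuous_map (subtopology X (D g)) euclideanreal (\<lambda>x. h (a g x))"
      using continuous_map_compose[OF continuous_a[OF w]] h by (auto simp: Q_def o_def)
  qed (use w h closed_D cl a_in in \<open>auto simp: Q_def A'_def B'_def attach\<close>)
  obtain \<phi> where \<phi>: "\<And>w. w \<in> W \<Longrightarrow> \<exists>h. Q w h \<and> (\<forall>x\<in>topspace X. \<phi> (i w x) = h x)"
    by (rule extend_to_atlas[OF base step]) blast+
  show "\<exists>f. continuous_map Y euclideanreal f \<and> f ` A \<subseteq> {0} \<and> f ` B \<subseteq> {1}"
  proof (intro exI conjI)
    show "continuous_map Y euclideanreal \<phi>"
    proof (rule continuous_map_from_Y)
      fix w assume "w \<in> W"
      with \<phi> obtain h where "Q w h" "\<forall>x\<in>topspace X. \<phi> (i w x) = h x" by blast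
      then show "continuous_map X euclideanreal (\<lambda>x. \<phi> (i w x))"
        unfolding Q_def using continuous_map_eq[of X euclideanreal h] by auto
    qed
    have "\<phi> (i w x) = (if i w x \<in> A then 0 else 1)"
      if "w \<in> W" "x \<in> topspace X" "i w x \<in> A \<union> B" for w x
      using \<phi>[OF that(1)] that AB(3) by (auto simp: Q_def A'_def B'_def disjnt_iff)
    moreover have "\<exists>w\<in>W. \<exists>x\<in>topspace X. y = i w x" if "y \<in> A \<union> B" for y
      using that AB closedin_subset topspace_Y by blast
    ultimately have "\<phi> y = (if y \<in> A then 0 else 1)" if "y \<in> A \<union> B" for y
      using that by metis
    then show "\<phi> ` A \<subseteq> {0}" "\<phi> ` B \<subseteq> {1}" using AB(3) by (auto simp: disjnt_iff)
  qed
qed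

section \<open>Covering dimension of the glued space\<close>

text \<open>A thin partition indexed by the cover itself is glued from the copies; the positivity
  sets of its coordinates form the refinement. Since \<open>N\<close> is the dimension plus one,
  dimension -1 is included.\<close>

lemma covering_dim_le_Y:
  assumes X: "normal_space X" and dim: "covering_dim_le X (int N - 1)"
  shows "covering_dim_le Y (int N - 1)"
  unfolding covering_dim_le_def
proof (intro allI impI, elim conjE)
  fix \<U> assume \<U>: "finite \<U>" "open_cover Y \<U>"
  define U where "U w V = {x \<in> topspace X. i w x \<in> V}" for w V
  have opU: "openin X (U w V)" if "w \<in> W" "V \<in> \<U>" for w V
    using that \<U>(2) by (auto simp: U_def open_cover_def openin_Y)
  have covU: "topspace X \<subseteq> (\<Union>V\<in>\<U>. U w V)" if "w \<in> W" for w
    using that \<U>(2) i_in by (auto simp: U_def open_cover_def)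
  define Q where "Q w h \<longleftrightarrow> thin_partition X (topspace X) \<U> (U w) N h" for w h
  \<comment> \<open>Used with \<open>A\<close> empty for the first copy and with
    \<open>A = D g\<close> for the later ones.\<close>
  have ext: "\<exists>h'. Q w h' \<and> (\<forall>x\<in>A. \<forall>V\<in>\<U>. h' x V = h x V)"
    if "w \<in> W" "closedin X A" "thin_partition X A \<U> (U w) N h" for w A h
    using thin_partition_extend[OF X dim \<open>finite \<U>\<close> opU covU that(2,3)] that(1)
    unfolding Q_def by metis
  have base: "\<exists>h. Q [] h"
    using ext[OF Nil_W closedin_empty, of "\<lambda>x V. 0"] by (auto simp: thin_partition_def)
  have step: "\<exists>h'. Q (w @ [g]) h' \<and> (\<forall>x\<in>D g. h' x = h (a g x))"
    if w: "w @ [g] \<in> W" and h: "Q w h" for w g h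
  proof -
    have "thin_partition X (D g) \<U> (U (w @ [g])) N (\<lambda>x. h (a g x))"
      unfolding thin_partition_def
    proof (intro conjI ballI impI)
      fix V assume "V \<in> \<U>"
      then have "continuous_map X euclideanreal (\<lambda>x. h x V)"
        using h by (simp add: Q_def thin_partition_def)
      then show "continuous_map (subtopology X (D g)) euclideanreal (\<lambda>x. h (a g x) V)"
        using continuous_map_compose[OF continuous_a[OF w]] by (auto simp: o_def)
    next
      fix x V assume "x \<in> D g" "V \<in> \<U>" "x \<notin> U (w @ [g]) V"
      moreover from this have "a g x \<notin> U w V"
        using D_subset[OF w] attach[OF w] by (auto simp: U_def)
      ultimately show "h (a g x) V = 0"
        using h a_in[OF w] by (auto simp: Q_def thin_partition_def)
    qed (use h a_in[OF w] in \<open>auto simp: Q_def thin_partition_def\<close>)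
    then obtain h' where h': "Q (w @ [g]) h'" "\<forall>x\<in>D g. \<forall>V\<in>\<U>. h' x V = h (a g x) V"
      using ext[OF w closed_D[OF w]] by metis
    \<comment> \<open>\<open>thin_partition\<close> sees only coordinates in \<open>\<U>\<close>,
      whereas gluing needs equality of whole functions; the other coordinates are copied from
      \<open>h\<close>.\<close>
    define h'' where "h'' x V = (if V \<in> \<U> then h' x V else h (a g x) V)" for x V
    have "Q (w @ [g]) h''"
      using h'(1) by (simp add: Q_def thin_partition_def h''_def cong: conj_cong)
    moreover have "\<forall>x\<in>D g. h'' x = h (a g x)"
      using h'(2) by (auto simp: h''_def)
    ultimately show ?thesis by blast
  qed
  obtain \<phi> where \<phi>: "\<And>w. w \<in> W \<Longrightarrow> \<exists>h. Q w h \<and> (\<forall>x\<in>topspace X. \<phi> (i w x) = h x)"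
    by (rule extend_to_atlas[OF base step]) blast+
  have c\<phi>: "continuous_map Y euclideanreal (\<lambda>y. \<phi> y V)" if "V \<in> \<U>" for V
  proof (rule continuous_map_from_Y)
    fix w assume "w \<in> W"
    with \<phi> obtain h where "Q w h" and h: "\<forall>x\<in>topspace X. \<phi> (i w x) = h x" by blast
    then have "continuous_map X euclideanreal (\<lambda>x. h x V)"
      using that by (simp add: Q_def thin_partition_def)
    then show "continuous_map X euclideanreal (\<lambda>x. \<phi> (i w x) V)"
      using h by (auto intro: continuous_map_eq)
  qed
  have point: "(\<forall>V\<in>\<U>. 0 \<le> \<phi> y V \<and> (y \<notin> V \<longrightarrow> \<phi> y V = 0)) \<and> (\<Sum>V\<in>\<U>. \<phi> y V) = 1 \<and>
      card {V \<in> \<U>. 0 < \<phi> y V} \<le> N" if yY: "y \<in> topspace Y" for y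
  proof -
    obtain w x where "w \<in> W" and x: "x \<in> topspace X" and y: "y = i w x"
      using yY unfolding topspace_Y by blast
    with \<phi> obtain h where "Q w h" "\<phi> y = h x" by blast
    then show ?thesis using x y by (auto simp: Q_def thin_partition_def U_def)
  qed
  define P where "P V = {y \<in> topspace Y. \<phi> y V \<in> {0<..}}" for V
  have "openin Y (P V)" if "V \<in> \<U>" for V
    unfolding P_def using c\<phi>[OF that] by (rule openin_continuous_map_preimage) auto
  moreover have "y \<in> (\<Union>V\<in>\<U>. P V)" if y: "y \<in> topspace Y" for y
  proof -
    have "\<exists>V\<in>\<U>. \<phi> y V \<noteq> 0" using point[OF y] by (metis sum.neutral zero_neq_one)
    then show ?thesis using point[OF y] y by (fastforce simp: P_def)
  qed
  ultimately have cov: "open_cover Y (P ` \<U>)"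
    by (auto simp: open_cover_def P_def)
  have sub: "\<forall>Z\<in>P ` \<U>. \<exists>V\<in>\<U>. Z \<subseteq> V"
  proof clarify
    fix V assume "V \<in> \<U>"
    then have "P V \<subseteq> V" using point by (force simp: P_def)
    then show "\<exists>Z\<in>\<U>. P V \<subseteq> Z" using \<open>V \<in> \<U>\<close> by blast
  qed
  have "int (card {Z \<in> P ` \<U>. y \<in> Z}) \<le> int N - 1 + 1" if y: "y \<in> topspace Y" for y
  proof -
    \<comment> \<open>Different members of the cover may have equal positivity sets, so the count
      goes through an image.\<close>
    have "{Z \<in> P ` \<U>. y \<in> Z} \<subseteq> P ` {V \<in> \<U>. 0 < \<phi> y V}" by (auto simp: P_def)
    then have "card {Z \<in> P ` \<U>. y \<in> Z} \<le> card {V \<in> \<U>. 0 < \<phi> y V}"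
      using \<open>finite \<U>\<close> by (intro surj_card_le) simp_all
    then show ?thesis using point[OF y] by linarith
  qed
  with cov sub \<open>finite \<U>\<close> show "\<exists>\<V>. finite \<V> \<and> open_cover Y \<V> \<and> (\<forall>V\<in>\<V>. \<exists>U\<in>\<U>. V \<subseteq> U) \<and>
      (\<forall>y\<in>topspace Y. int (card {V \<in> \<V>. y \<in> V}) \<le> int N - 1 + 1)"
    by (intro exI[of _ "P ` \<U>"]) simp
qed

text \<open>Points of the base copy are reduced with the empty word, so the image of
  \<open>A\<close> has reduced part \<open>A\<close> there and none in the other copies.\<close>

lemma closed_map_base: "closed_map X Y (i [])"
  unfolding closed_map_def
proof (intro allI impI closedin_Y_reduced)
  fix A w assume A: "closedin X A" and "w \<in> W"
  have base: "reduced [] x" if "x \<in> A" for x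
    using that closedin_subset[OF A] Nil_W by (auto simp: reduced_def)
  then have "{x. reduced w x \<and> i w x \<in> i [] ` A} = (if w = [] then A else {})"
    by (auto dest: reduced_inj)
  then show "closedin X {x. reduced w x \<and> i w x \<in> i [] ` A}" using A by simp
qed (use i_in Nil_W closedin_subset in blast)

lemma inj_on_base: "inj_on (i []) (topspace X)"
  using reduced_inj[of "[]" _ "[]"] Nil_W by (auto simp: inj_on_def reduced_def)

end

section \<open>Covering dimension of closed subspaces\<close>

text \<open>The largest subset of \<open>Y\<close> with preimage \<open>U\<close> is the complement
  of the image of \<open>topspace X - U\<close>, which is open because \<open>e\<close> is closed.
  An open cover of \<open>X\<close> is thus enlarged to one of \<open>Y\<close>, refined there and
  pulled back.\<close>

lemma covering_dim_le_closed_embedding: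
  assumes cont: "continuous_map X Y e" and closed: "closed_map X Y e"
    and inj: "inj_on e (topspace X)" and dim: "covering_dim_le Y n"
  shows "covering_dim_le X n"
  unfolding covering_dim_le_def
proof (intro allI impI, elim conjE)
  fix \<U> assume \<U>: "finite \<U>" "open_cover X \<U>"
  let ?O = "\<lambda>U. topspace Y - e ` (topspace X - U)"
  \<comment> \<open>\<open>?O {}\<close> is the complement of the image and covers the points
    outside it, even when \<open>\<U>\<close> is empty.\<close>
  let ?\<O> = "insert (?O {}) (?O ` \<U>)"
  have "openin Y (?O U)" if "U \<in> insert {} \<U>" for U
  proof -
    have "openin X U" using that \<U>(2) by (auto simp: open_cover_def)
    then have "closedin Y (e ` (topspace X - U))" using closed by (auto simp: closed_map_def)
    then show ?thesis by blast
  qed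
  moreover have "y \<in> \<Union>?\<O>" if y: "y \<in> topspace Y" for y
  proof (cases "y \<in> e ` topspace X")
    case True
    then obtain x where x: "x \<in> topspace X" "y = e x" by blast
    then obtain U where "U \<in> \<U>" "x \<in> U" using \<U>(2) by (auto simp: open_cover_def)
    then have "y \<in> ?O U" using x y inj by (auto dest: inj_onD)
    then show ?thesis using \<open>U \<in> \<U>\<close> by blast
  qed (use y in auto)
  ultimately have "open_cover Y ?\<O>" unfolding open_cover_def by blast
  then obtain \<V> where \<V>: "finite \<V>" "open_cover Y \<V>" "\<forall>V\<in>\<V>. \<exists>U\<in>?\<O>. V \<subseteq> U"
    "\<forall>y\<in>topspace Y. int (card {V \<in> \<V>. y \<in> V}) \<le> n + 1"
    using dim[unfolded covering_dim_le_def, rule_format, of ?\<O>] \<U>(1) by blast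
  define e' where "e' V = {x \<in> topspace X. e x \<in> V}" for V
  \<comment> \<open>Members inside \<open>?O {}\<close> pull back to the empty set, which has no
    superset in \<open>\<U>\<close> if \<open>\<U>\<close> is empty; so it is dropped.\<close>
  let ?\<W> = "e' ` \<V> - {{}}"
  have eY: "e x \<in> topspace Y" if "x \<in> topspace X" for x
    using cont that by (auto simp: continuous_map_def)
  have "openin X (e' V)" if "V \<in> \<V>" for V
    using cont \<V>(2) that by (auto simp: e'_def continuous_map_def open_cover_def)
  moreover have "x \<in> \<Union>?\<W>" if x: "x \<in> topspace X" for x
  proof -
    obtain V where "V \<in> \<V>" "e x \<in> V" using eY[OF x] \<V>(2) by (auto simp: open_cover_def)
    then have "x \<in> e' V" "e' V \<in> e' ` \<V>" using x by (auto simp: e'_def)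
    then show ?thesis by blast
  qed
  ultimately have "open_cover X ?\<W>" by (auto simp: open_cover_def e'_def)
  moreover have "\<exists>U\<in>\<U>. Z \<subseteq> U" if Z: "Z \<in> ?\<W>" for Z
  proof -
    obtain V where V: "V \<in> \<V>" "Z = e' V" "e' V \<noteq> {}" using Z by blast
    then obtain U where U: "U \<in> insert {} \<U>" "V \<subseteq> ?O U" using \<V>(3) by blast
    then have "e' V \<subseteq> U" by (auto simp: e'_def)
    then show ?thesis using U V by auto
  qed
  moreover have "int (card {Z \<in> ?\<W>. x \<in> Z}) \<le> n + 1" if x: "x \<in> topspace X" for x
  proof -
    have "{Z \<in> ?\<W>. x \<in> Z} \<subseteq> e' ` {V \<in> \<V>. e x \<in> V}" by (auto simp: e'_def)
    with \<V>(1) have "card {Z \<in> ?\<W>. x \<in> Z} \<le> card {V \<in> \<V>. e x \<in> V}"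
      by (intro surj_card_le) auto
    then show ?thesis using \<V>(4) eY[OF x] by force
  qed
  ultimately show "\<exists>\<V>. finite \<V> \<and> open_cover X \<V> \<and> (\<forall>V\<in>\<V>. \<exists>U\<in>\<U>. V \<subseteq> U) \<and>
      (\<forall>x\<in>topspace X. int (card {V \<in> \<V>. x \<in> V}) \<le> n + 1)"
    using \<V>(1) by (intro exI[of _ ?\<W>]) blast
qed

theorem (in word_atlas) covering_dim_Y:
  assumes "normal_space X"
  shows "covering_dim Y = covering_dim X"
proof -
  have "covering_dim_le Y n \<longleftrightarrow> covering_dim_le X n" if "-1 \<le> n" for n
  proof
    show "covering_dim_le X n" if "covering_dim_le Y n"
      using covering_dim_le_closed_embedding[OF continuous_map_i[OF Nil_W] closed_map_base inj_on_base that] .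
    show "covering_dim_le Y n" if "covering_dim_le X n"
      using covering_dim_le_Y[OF assms, of "nat (n + 1)"] that \<open>-1 \<le> n\<close> by simp
  qed
  then show ?thesis unfolding covering_dim_def by metis
qed


section \<open>Normal forms in the globalization\<close>

locale confluent_action =
  fixes M :: "('m, 'b) monoid_scheme" and S :: "'x set" and act :: "'m \<Rightarrow> 'x \<rightharpoonup> 'x"
    and G :: "'g set" and R :: "('g list \<times> 'g list) set" and \<phi> :: "'g list set \<Rightarrow> 'm"
  assumes partial: "partial_action M S act"
    and pres: "confluent_presentation G R"
    and iso: "\<phi> \<in> iso (presented_monoid G R) M"
    and unique_nf: "\<And>w x. w \<in> lists G \<Longrightarrow> x \<in> S \<Longrightarrow>
      \<exists>!q. normal_form_of (act_step G R \<phi> S act) (w, x) q"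
    and act_reduces: "\<And>w x y. w \<in> lists G \<Longrightarrow> x \<in> S \<Longrightarrow> act (word_val G R \<phi> w) x = Some y \<Longrightarrow>
      (act_step G R \<phi> S act)\<^sup>*\<^sup>* (w, x) ([], y)"
begin

abbreviation val :: "'g list \<Rightarrow> 'm" where "val \<equiv> word_val G R \<phi>"
abbreviation step :: "'g list \<times> 'x \<Rightarrow> 'g list \<times> 'x \<Rightarrow> bool" where "step \<equiv> act_step G R \<phi> S act"
abbreviation cls :: "'m \<Rightarrow> 'x \<Rightarrow> ('m \<times> 'x) set" where "cls \<equiv> glob_class M S act"

section \<open>Words and the monoid elements they represent\<close>

definition normal_words :: "'g list set" where
  "normal_words = {w \<in> lists G. normal_elem (word_step G R) w}"

lemma carrier_presented: "carrier (presented_monoid G R) = lists G // word_rel G R"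
  by (simp add: presented_monoid_def)

lemma val_in: "w \<in> lists G \<Longrightarrow> val w \<in> carrier M"
  using iso carrier_presented unfolding iso_def hom_def word_val_def
  by (auto intro: quotientI)

lemma val_append: "v \<in> lists G \<Longrightarrow> w \<in> lists G \<Longrightarrow> val (v @ w) = val v \<otimes>\<^bsub>M\<^esub> val w"
  using iso hom_mult[of \<phi> "presented_monoid G R" M "word_rel G R `` {v}" "word_rel G R `` {w}"]
  unfolding iso_def word_val_def
  by (auto simp: carrier_presented presented_monoid_mult quotientI)

lemma val_eq_iff:
  assumes "v \<in> lists G" "w \<in> lists G"
  shows "val v = val w \<longleftrightarrow> equivclp (word_step G R) v w"
proof -
  have "inj_on \<phi> (lists G // word_rel G R)"
    using iso by (simp add: iso_def bij_betw_def carrier_presented)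
  then have "val v = val w \<longleftrightarrow> word_rel G R `` {v} = word_rel G R `` {w}"
    unfolding word_val_def using assms by (metis inj_onD quotientI)
  also have "\<dots> \<longleftrightarrow> (v, w) \<in> word_rel G R"
    using eq_equiv_class_iff[OF equiv_word_rel assms] .
  finally show ?thesis using assms by (simp add: word_rel_def)
qed

lemma val_surj:
  assumes "u \<in> carrier M"
  obtains w where "w \<in> lists G" "val w = u"
proof -
  have "u \<in> \<phi> ` (lists G // word_rel G R)"
    using iso assms by (simp add: iso_def bij_betw_def carrier_presented)
  then show thesis using that by (auto simp: word_val_def elim!: quotientE)
qed

lemma word_step_lists: "word_step G R v w \<Longrightarrow> v \<in> lists G \<and> w \<in> lists G"
proof (elim word_step.cases, intro conjI)
  have R: "l \<in> lists G \<and> r \<in> lists G" if "(l, r) \<in> R" for l r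
    using pres that unfolding confluent_presentation_def by blast
  fix w\<^sub>1 w\<^sub>2 l r
  assume "v = w\<^sub>1 @ l @ w\<^sub>2" "w = w\<^sub>1 @ r @ w\<^sub>2" "w\<^sub>1 \<in> lists G" "w\<^sub>2 \<in> lists G" "(l, r) \<in> R"
  then show "v \<in> lists G" "w \<in> lists G" using R[of l r] by simp_all
qed

lemma equivclp_word_step_lists:
  "equivclp (word_step G R) v w \<Longrightarrow> v \<in> lists G \<Longrightarrow> w \<in> lists G"
  by (induction rule: equivclp_induct) (auto dest: word_step_lists simp del: in_lists_conv_set)

lemma normal_word_surj:
  assumes "u \<in> carrier M"
  obtains w where "w \<in> normal_words" "val w = u"
proof -
  obtain v where v: "v \<in> lists G" "val v = u" using val_surj assms .
  then obtain w where w: "normal_form_of (word_step G R) v w"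
    using pres unfolding confluent_presentation_def by blast
  then have "w \<in> lists G" using v equivclp_word_step_lists by (auto simp: normal_form_of_def)
  then have "val w = u" using w v val_eq_iff[of v w] by (simp add: normal_form_of_def)
  moreover have "w \<in> normal_words"
    using \<open>w \<in> lists G\<close> w by (simp add: normal_words_def normal_form_of_def)
  ultimately show thesis by (rule that[rotated])
qed

text \<open>A reduction of a prefix is a reduction of the whole word. This makes the index set of
  the atlas closed under prefixes.\<close>

lemma prefix_normal_words:
  assumes "v @ w \<in> normal_words"
  shows "v \<in> normal_words"
  using assms word_step_append[of G R v _ "[]" w] by (auto simp: normal_words_def normal_elem_def)

text \<open>The empty word has some normal form, and it is a prefix of that normal word.\<close>

lemma Nil_normal_words: "[] \<in> normal_words"
proof -
  have "[] \<in> lists G" by simp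
  then obtain w where "normal_form_of (word_step G R) [] w"
    using pres unfolding confluent_presentation_def by blast
  then have "w \<in> normal_words"
    using equivclp_word_step_lists by (auto simp: normal_words_def normal_form_of_def)
  then show ?thesis using prefix_normal_words[of "[]" w] by simp
qed

section \<open>Classes of the globalization and reduction of pairs\<close>

lemma act_in: "u \<in> carrier M \<Longrightarrow> x \<in> S \<Longrightarrow> act u x = Some y \<Longrightarrow> y \<in> S"
  using partial unfolding partial_action_def by blast

lemma class_eqI:
  assumes "u \<in> carrier M" "v \<in> carrier M" "x \<in> S" "act v x = Some y" "u \<otimes>\<^bsub>M\<^esub> v \<in> carrier M"
  shows "cls (u \<otimes>\<^bsub>M\<^esub> v) x = cls u y"
proof -
  have "y \<in> S" using act_in assms by blast
  then have "((u \<otimes>\<^bsub>M\<^esub> v, x), (u, y)) \<in> glob_rel M S act"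
    using assms by (auto simp: glob_rel_def intro!: r_into_equivclp glob_step.intros)
  then show ?thesis unfolding glob_class_def by (rule equiv_class_eq[OF equiv_glob_rel])
qed

lemma class_snoc:
  assumes "w @ [g] \<in> lists G" "x \<in> act_dom S act (val [g])"
  shows "cls (val (w @ [g])) x = cls (val w) (the (act (val [g]) x))"
  using assms class_eqI[of "val w" "val [g]" x] val_in[of "w @ [g]"]
  by (auto simp: act_dom_def val_append val_in)

text \<open>Letters act from the right end and rules apply anywhere, so letters added on the left do
  not disturb a reduction.\<close>

lemma steps_prefix:
  assumes "step\<^sup>*\<^sup>* p q" "v \<in> lists G"
  shows "step\<^sup>*\<^sup>* (v @ fst p, snd p) (v @ fst q, snd q)"
  using assms(1)
proof induction
  case (step q r)
  have "act_step G R \<phi> S act (v @ fst q, snd q) (v @ fst r, snd r)"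
    using step(2)
  proof cases
    case (apply_letter w g x y)
    then show ?thesis using act_step.apply_letter[of "v @ w" G g] assms(2) by auto
  next
    case (reduce_word w w' x)
    then show ?thesis
      using word_step_append[of G R w w' v "[]"] assms(2) by (auto intro: act_step.reduce_word)
  qed
  then show ?case using step.IH by simp
qed simp

lemma equivclp_reduce_word:
  assumes "equivclp (word_step G R) v w" "x \<in> S"
  shows "equivclp step (v, x) (w, x)"
  using assms(1)
proof (induction rule: equivclp_induct)
  case (step w w')
  then have "act_step G R \<phi> S act (w, x) (w', x) \<or> act_step G R \<phi> S act (w', x) (w, x)"
    using act_step.reduce_word[OF _ assms(2)] by meson
  with step.IH show ?case by (rule equivclp_into_equivclp)
qed simp

lemma glob_step_in:
  assumes "glob_step M S act p q"
  shows "p \<in> carrier M \<times> S \<and> q \<in> carrier M \<times> S"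
  using assms
proof cases
  case (1 u v x y)
  obtain w z where wz: "w \<in> lists G" "val w = u" "z \<in> lists G" "val z = v"
    using val_surj 1 by metis
  then have "u \<otimes>\<^bsub>M\<^esub> v \<in> carrier M" using val_in[of "w @ z"] by (simp add: val_append)
  moreover have "y \<in> S" using act_in 1 by blast
  ultimately show ?thesis using 1 by simp
qed

text \<open>Take a word \<open>z\<close> for the factor that acts. By \<open>act_reduces\<close> the
  pair \<open>(z, x)\<close> reduces to the empty word, and this stays true behind the prefix
  \<open>w'\<close>; finally \<open>w\<close> and \<open>w' @ z\<close> represent the same
  element.\<close>

lemma equivclp_step_of_glob_step:
  assumes "glob_step M S act (u, x) (u', x')"
    and "w \<in> lists G" "val w = u" "w' \<in> lists G" "val w' = u'"
  shows "equivclp step (w, x) (w', x')"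
  using assms(1)
proof cases
  case (1 v)
  then obtain z where z: "z \<in> lists G" "val z = v" using val_surj by blast
  have "step\<^sup>*\<^sup>* (z, x) ([], x')" using act_reduces z 1 by blast
  from steps_prefix[OF this \<open>w' \<in> lists G\<close>] have "equivclp step (w' @ z, x) (w', x')"
    using predicate2D[OF rtranlcp_le_equivclp] by fastforce
  moreover have "equivclp (word_step G R) w (w' @ z)"
    using assms z 1 by (subst val_eq_iff[symmetric]) (auto simp: val_append)
  then have "equivclp step (w, x) (w' @ z, x)" using equivclp_reduce_word 1 by blast
  ultimately show ?thesis by (rule equivclp_trans[rotated])
qed

lemma equivclp_step_of_class_eq:
  assumes "w \<in> lists G" "w' \<in> lists G" "x \<in> S" "x' \<in> S" and eq: "cls (val w) x = cls (val w') x'"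
  shows "equivclp step (w, x) (w', x')"
proof -
  have "((val w, x), (val w', x')) \<in> glob_rel M S act"
    using eq assms eq_equiv_class_iff[OF equiv_glob_rel, of "(val w, x)" M S "(val w', x')" act]
    by (simp add: glob_class_def val_in)
  then have "equivclp (glob_step M S act) (val w, x) (val w', x')"
    by (simp add: glob_rel_def)
  \<comment> \<open>The intermediate pairs carry monoid elements instead of words, so the invariant
    covers every word representing them; the membership claims ensure that such words exist.\<close>
  then have "fst (val w', x') \<in> carrier M \<and> snd (val w', x') \<in> S \<and>
    (\<forall>v\<in>lists G. val v = fst (val w', x') \<longrightarrow> equivclp step (w, x) (v, snd (val w', x')))"
  proof (induction rule: equivclp_induct)
    case base
    have "equivclp (act_step G R \<phi> S act) (w, x) (v, x)" if "v \<in> lists G" "val v = val w" for v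
      using that val_eq_iff[of w v] equivclp_reduce_word[of w v x] assms by simp
    then show ?case using assms val_in by simp
  next
    case (step p q)
    have q: "fst q \<in> carrier M" "snd q \<in> S"
      using step(2) glob_step_in[of p q] glob_step_in[of q p] by auto
    obtain v where v: "v \<in> lists G" "val v = fst p" using val_surj step.IH by blast
    have "equivclp (act_step G R \<phi> S act) (w, x) (v', snd q)"
      if v': "v' \<in> lists G" "val v' = fst q" for v'
    proof -
      have "equivclp (act_step G R \<phi> S act) (v, snd p) (v', snd q)"
        using step(2) equivclp_step_of_glob_step[of "fst p" "snd p" "fst q" "snd q" v v']
          equivclp_step_of_glob_step[of "fst q" "snd q" "fst p" "snd p" v' v] v v'
        by (auto intro: equivclp_sym)
      then show ?thesis using step.IH v by (blast intro: equivclp_trans)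
    qed
    with q show ?case by blast
  qed
  then show ?thesis using assms by simp
qed

text \<open>Normality of \<open>w\<close> excludes rule steps, and only the last letter could be
  applied to \<open>x\<close>.\<close>

lemma normal_pair:
  assumes "w \<in> normal_words" "w = [] \<or> x \<notin> act_dom S act (val [last w])"
  shows "normal_elem step (w, x)"
  unfolding normal_elem_def
proof
  assume "\<exists>q. step (w, x) q"
  then obtain q where "step (w, x) q" ..
  then show False
    by cases (use assms in \<open>auto simp: normal_words_def normal_elem_def act_dom_def\<close>)
qed

text \<open>Equal classes make the pairs equivalent under reduction; both are normal, so they are
  normal forms of the same pair. This supplies \<open>reduced_unique\<close> for the atlas.\<close>

lemma normal_pair_unique:
  assumes "w \<in> normal_words" "w' \<in> normal_words" "x \<in> S" "x' \<in> S"
    and "w = [] \<or> x \<notin> act_dom S act (val [last w])"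
    and "w' = [] \<or> x' \<notin> act_dom S act (val [last w'])"
    and "cls (val w) x = cls (val w') x'"
  shows "w = w' \<and> x = x'"
proof -
  have lists: "w \<in> lists G" "w' \<in> lists G" using assms by (auto simp: normal_words_def)
  have "equivclp step (w, x) (w', x')"
    using equivclp_step_of_class_eq lists assms by blast
  then have "normal_form_of step (w, x) (w', x')" "normal_form_of step (w, x) (w, x)"
    using normal_pair assms by (auto simp: normal_form_of_def)
  then show ?thesis using unique_nf[OF lists(1) \<open>x \<in> S\<close>] by blast
qed

section \<open>The globalization as a space glued along normal words\<close>

lemma word_atlas_globalization:
  assumes S: "S = topspace X" and cont: "continuous_partial_action M X act"
    and closed: "closed_partial_action M X act"
  shows "word_atlas X (globalization M X act) normal_words (\<lambda>g. act_dom S act (val [g]))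
    (\<lambda>g x. the (act (val [g]) x)) (\<lambda>w. cls (val w))"
proof
  fix w g assume w: "w @ [g] \<in> normal_words"
  then have "w @ [g] \<in> lists G" by (simp add: normal_words_def)
  then have g: "val [g] \<in> carrier M" using val_in[of "[g]"] by simp
  show "w \<in> normal_words" using prefix_normal_words w .
  show "closedin X (act_dom S act (val [g]))"
    using closed g S by (simp add: closed_partial_action_def)
  show "continuous_map (subtopology X (act_dom S act (val [g]))) X (\<lambda>x. the (act (val [g]) x))"
    using cont g S by (simp add: continuous_partial_action_def)
  show "cls (val (w @ [g])) x = cls (val w) (the (act (val [g]) x))"
    if "x \<in> act_dom S act (val [g])" for x
    using class_snoc \<open>w @ [g] \<in> lists G\<close> that .
next
  \<comment> \<open>The final topology refers to all elements of \<open>M\<close>, the atlas only to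
    normal words; by this identity the two families of maps coincide.\<close>
  have carrier: "carrier M = val ` normal_words"
  proof (intro equalityI subsetI)
    show "u \<in> val ` normal_words" if "u \<in> carrier M" for u
      using normal_word_surj[OF that] by blast
  qed (auto simp: normal_words_def intro: val_in)
  have "glob_points M S act = (\<Union>u\<in>carrier M. cls u ` S)"
    by (auto simp: glob_points_def glob_class_def quotient_def)
  then show "topspace (globalization M X act) = (\<Union>w\<in>normal_words. cls (val w) ` topspace X)"
    by (simp add: topspace_globalization carrier S)
  show "openin (globalization M X act) U \<longleftrightarrow> U \<subseteq> topspace (globalization M X act) \<and>
      (\<forall>w\<in>normal_words. openin X {x \<in> topspace X. cls (val w) x \<in> U})" for U
    unfolding openin_globalization topspace_globalization carrier S by simp
next
  fix w w' x x'
  assume "w \<in> normal_words" "w' \<in> normal_words" "x \<in> topspace X" "x' \<in> topspace X"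
    "w = [] \<or> x \<notin> act_dom S act (val [last w])" "w' = [] \<or> x' \<notin> act_dom S act (val [last w'])"
    "cls (val w) x = cls (val w') x'"
  then show "w = w' \<and> x = x'" using normal_pair_unique S by simp
qed (rule Nil_normal_words)

end

theorem corollary4p11:
  fixes M :: "('m, 'b) monoid_scheme"
    and X :: "'x topology"
    and act :: "'m \<Rightarrow> 'x \<rightharpoonup> 'x"
    and n :: ereal
  assumes "monoid M"
    and "continuous_partial_action M X act"
    and "closed_partial_action M X act"
    and "confluent_partial_action TYPE('g) M (topspace X) act"
    and "normal_T1_space X"
  shows "normal_T1_space (globalization M X act) \<and>
    (covering_dim X = n \<longrightarrow> covering_dim (globalization M X act) = n)"
proof -
  obtain G :: "'g set" and R \<phi> where "confluent_presentation G R"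
    "\<phi> \<in> iso (presented_monoid G R) M"
    "\<forall>w\<in>lists G. \<forall>x\<in>topspace X. \<exists>!q. normal_form_of (act_step G R \<phi> (topspace X) act) (w, x) q"
    "\<forall>w\<in>lists G. \<forall>x\<in>topspace X. \<forall>y. act (word_val G R \<phi> w) x = Some y \<longrightarrow>
       (act_step G R \<phi> (topspace X) act)\<^sup>*\<^sup>* (w, x) ([], y)"
    using assms(4) unfolding confluent_partial_action_def by (elim exE conjE)
  with assms(2) have "confluent_action M (topspace X) act G R \<phi>"
    unfolding continuous_partial_action_def by unfold_locales blast+
  then interpret confluent_action M "topspace X" act G R \<phi> .
  interpret word_atlas X "globalization M X act" normal_words "\<lambda>g. act_dom (topspace X) act (val [g])"
    "\<lambda>g x. the (act (val [g]) x)" "\<lambda>w. cls (val w)"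
    using word_atlas_globalization[OF refl assms(2,3)] .
  show ?thesis
    using t1_space_Y normal_space_Y covering_dim_Y assms(5) by (simp add: normal_T1_space_def)
qed

end
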